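(* Let $n\in\mathbb N$ and let $T:\mathbb R_n[z]\to\mathbb R[z]$ be a linear operator. Then $T$ preserves hyperbolicity (i.e. $T(f)$ is hyperbolic or $0$ for every hyperbolic $f\in\mathbb R_n[z]$) if and only if one of the following holds: (a) $T$ has range of dimension at most two and is of the form $T(f)=\alpha(f)P+\beta(f)Q$ for $f\in\mathbb R_n[z]$, where $\alpha,\beta:\mathbb R_n[z]\to\mathbb R$ are linear functionals and $P,Q$ are hyperbolic polynomials whose zeros interlace; (b) $T[(z+w)^n]\in\mathcal H_2(\mathbb R)$; (c) $T[(z-w)^n]\in\mathcal H_2(\mathbb R)$.
   Context: $\mathbb R_n[z]$ denotes the real polynomials of degree at most $n$. A univariate polynomial is hyperbolic if it is non-zero, has real coefficients and all its zeros are real. A polynomial $f\in\mathbb C[z_1,\dots,z_k]$ is stable if it is non-zero and $f(z_1,\dots,z_k)\neq0$ whenever $\Im z_j>0$ for all $j$; it is real stable if moreover it has real coefficients. $\mathcal H_k(\mathbb C)$ (resp. $\mathcal H_k(\mathbb R)$) is the set of stable (resp. real stable) polynomials in $k$ variables. The zeros $\alpha_1\le\dots\le\alpha_p$ and $\beta_1\le\dots\le\beta_q$ of two hyperbolic polynomials interlace if either $\alpha_1\le\beta_1\le\alpha_2\le\beta_2\le\cdots$ or $\beta_1\le\alpha_1\le\beta_2\le\alpha_2\le\cdots$; by convention the zeros of any two polynomials of degree $0$ or $1$ interlace. A linear operator $T$ on univariate polynomials in $z$ is extended to polynomials in $z,w$ by $T(z^kw^\ell)=T(z^k)w^\ell$.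 *)

theory Defs
  imports "HOL-Computational_Algebra.Polynomial" "HOL-Analysis.Analysis"
begin

definition Rn :: "nat \<Rightarrow> real poly set" where
  "Rn n = {f. degree f \<le> n}"

definition hyperbolic :: "real poly \<Rightarrow> bool" where
  "hyperbolic f \<longleftrightarrow> f \<noteq> 0 \<and>
     (\<forall>z::complex. poly (map_poly complex_of_real f) z = 0 \<longrightarrow> Im z = 0)"

definition linear_on_Rn :: "nat \<Rightarrow> (real poly \<Rightarrow> 'b::real_vector) \<Rightarrow> bool" where
  "linear_on_Rn n T \<longleftrightarrow>
     (\<forall>f\<in>Rn n. \<forall>g\<in>Rn n. T (f + g) = T f + T g) \<and>
     (\<forall>c. \<forall>f\<in>Rn n. T (smult c f) = c *\<^sub>R T f)"

definition linear_op_Rn :: "nat \<Rightarrow> (real poly \<Rightarrow> real poly) \<Rightarrow> bool" where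
  "linear_op_Rn n T \<longleftrightarrow>
     (\<forall>f\<in>Rn n. \<forall>g\<in>Rn n. T (f + g) = T f + T g) \<and>
     (\<forall>c. \<forall>f\<in>Rn n. T (smult c f) = smult c (T f))"

function interleave :: "'a list \<Rightarrow> 'a list \<Rightarrow> 'a list" where
  "interleave [] ys = ys"
| "interleave (x # xs) ys = x # interleave ys xs"
  by pat_completeness auto
termination by (relation "Wellfounded.measure (\<lambda>(xs, ys). length xs + length ys)") auto

definition interlace_from :: "real list \<Rightarrow> real list \<Rightarrow> bool" where
  "interlace_from xs ys \<longleftrightarrow> length ys \<le> length xs \<and> length xs \<le> length ys + 1 \<and>
     sorted (interleave xs ys)"

definition is_zero_list :: "real poly \<Rightarrow> real list \<Rightarrow> bool" where
  "is_zero_list P xs \<longleftrightarrow> sorted xs \<and> P = smult (lead_coeff P) (\<Prod>x\<leftarrow>xs. [:-x, 1:])"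

definition zeros_interlace :: "real poly \<Rightarrow> real poly \<Rightarrow> bool" where
  "zeros_interlace P Q \<longleftrightarrow>
     (degree P \<le> 1 \<and> degree Q \<le> 1) \<or>
     (\<exists>xs ys. is_zero_list P xs \<and> is_zero_list Q ys \<and>
        (interlace_from xs ys \<or> interlace_from ys xs))"

text \<open>Bivariate real polynomials in z, w are represented as real poly poly:
  a polynomial in w whose coefficients are polynomials in z.\<close>
definition eval2 :: "real poly poly \<Rightarrow> complex \<Rightarrow> complex \<Rightarrow> complex" where
  "eval2 p z w = poly (map_poly (\<lambda>q. poly (map_poly complex_of_real q) z) p) w"

definition real_stable2 :: "real poly poly \<Rightarrow> bool" where
  "real_stable2 p \<longleftrightarrow> p \<noteq> 0 \<and>
     (\<forall>z w. Im z > 0 \<longrightarrow> Im w > 0 \<longrightarrow> eval2 p z w \<noteq> 0)"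

text \<open>T[(z + s w)^n] = sum_k C(n,k) s^(n-k) T(z^k) w^(n-k), for s = 1 or s = -1.\<close>
definition T_symbol :: "(real poly \<Rightarrow> real poly) \<Rightarrow> nat \<Rightarrow> real \<Rightarrow> real poly poly" where
  "T_symbol T n s = (\<Sum>k\<le>n. monom (smult (real (n choose k) * s ^ (n - k)) (T (monom 1 k))) (n - k))"

end

theory Submission
  imports Defs "HOL-Computational_Algebra.Fundamental_Theorem_Algebra"
    "HOL-Complex_Analysis.Great_Picard"
begin

text \<open>Write \<open>F(z, w) = T[(z + w)\<^sup>n]\<close> and let \<open>H\<close> be the open upper half-plane.

  If \<open>T\<close> preserves hyperbolicity and some \<open>T f\<close> is neither hyperbolic nor zero, then \<open>T p\<close> is nonzero,
  hence hyperbolic, for the real part \<open>p\<close> of \<open>c (z + w)\<^sup>n\<close> with \<open>w \<in> H\<close>, since all small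
  perturbations of \<open>p\<close> are hyperbolic. So \<open>c F(z, w) + cnj c F(z, cnj w)\<close> never vanishes, which means
  that \<open>\<bar>F(z, w)\<bar> - \<bar>F(z, cnj w)\<bar>\<close> has no zero on the connected set \<open>H \<times> H\<close>; its sign decides
  between (b) and (c). If all \<open>T f\<close> are hyperbolic or zero, evaluation at \<open>\<i>\<close> is injective on the
  range, which gives (a).

  Conversely, (b) and (c) are handled by the Grace-Walsh-Szego theorem and Hurwitz's theorem, and (a)
  by comparing the arguments of \<open>P\<close> and \<open>Q\<close> on \<open>H\<close>.\<close>


section \<open>Polynomials without zeros in the upper half-plane\<close>

text \<open>The obstacle is that a preserver may send hyperbolic polynomials to 0: for
  \<open>T f = \<alpha>(f) P\<close> with an arbitrary functional \<open>\<alpha>\<close> the symbol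
  need not be stable. An \<open>f\<close> whose image is neither hyperbolic nor zero removes this
  freedom. Hyperbolicity of the perturbed real parts is a Hermite-Biehler argument:
  \<open>c (z + w)^n\<close> has its only zero in the open lower half-plane and, up to a constant
  factor, dominates every polynomial of degree at most \<open>n\<close> on the closed upper
  half-plane; if all zeros of a nonconstant polynomial lie below the real axis, its coefficientwise
  real part is hyperbolic. The factor \<open>c\<close> is kept free because its phase turns one
  equation into a statement about moduli: two complex numbers A and B have equal modulus iff
  \<open>c A + cnj c B = 0\<close> for some nonzero \<open>c\<close>. Conversely, Grace-Walsh-Szego
  needs exactly \<open>n\<close> zeros in an open half-plane, whereas \<open>f\<close> has real
  zeros and possibly smaller degree; hence an approximation and a passage to the limit.\<close>

abbreviation ev :: "real poly \<Rightarrow> complex \<Rightarrow> complex" where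
  "ev f z \<equiv> poly (map_poly complex_of_real f) z"

lemma ev_add: "ev (f + g) z = ev f z + ev g z"
proof -
  have "map_poly complex_of_real (f + g) = map_poly of_real f + map_poly of_real g"
    by (intro poly_eqI) (simp add: coeff_map_poly)
  then show ?thesis by simp
qed

lemma ev_smult: "ev (smult c f) z = of_real c * ev f z"
  by (simp add: map_poly_smult)

lemma ev_mult: "ev (f * g) z = ev f z * ev g z"
proof -
  have "map_poly complex_of_real (f * g) = map_poly of_real f * map_poly of_real g"
    by (intro poly_eqI) (simp add: coeff_map_poly coeff_mult)
  then show ?thesis by simp
qed

lemma ev_sum: "ev (\<Sum>k\<in>A. f k) z = (\<Sum>k\<in>A. ev (f k) z)"
  by (induction A rule: infinite_finite_induct) (simp_all add: ev_add)

lemma ev_cnj: "ev f (cnj z) = cnj (ev f z)"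
proof -
  have "map_poly cnj (map_poly complex_of_real f) = map_poly of_real f"
    by (intro poly_eqI) (simp add: coeff_map_poly)
  then show ?thesis using poly_cnj[of "map_poly complex_of_real f" z] by simp
qed

lemma ev_linear: "ev [:a, 1:] z = of_real a + z"
  by (simp add: map_poly_pCons)

lemma ev_of_real: "ev f (of_real x) = of_real (poly f x)"
  by (induction f) (simp_all add: map_poly_pCons)

lemma ev_holomorphic: "(\<lambda>z. ev f z) holomorphic_on S"
  by (intro holomorphic_intros)

text \<open>Nonreal zeros of a real polynomial come in conjugate pairs, so one half-plane is enough;
  the polynomial 0 fails the right-hand side because it vanishes everywhere.\<close>

lemma hyperbolic_iff:
  "hyperbolic f \<longleftrightarrow> (\<forall>z. Im z > 0 \<longrightarrow> ev f z \<noteq> 0)"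
proof
  show "hyperbolic f \<Longrightarrow> \<forall>z. Im z > 0 \<longrightarrow> ev f z \<noteq> 0"
    unfolding hyperbolic_def by fastforce
next
  assume *: "\<forall>z. Im z > 0 \<longrightarrow> ev f z \<noteq> 0"
  have "f \<noteq> 0" using *[rule_format, of \<i>] by auto
  moreover have "Im z = 0" if "ev f z = 0" for z
  proof -
    have "\<not> Im z > 0" using * that by blast
    moreover have "\<not> Im (cnj z) > 0" using *[rule_format, of "cnj z"] that ev_cnj[of f z] by auto
    ultimately show ?thesis by simp
  qed
  ultimately show "hyperbolic f" unfolding hyperbolic_def by blast
qed

lemma eq_0_if_ev_upper_0:
  assumes "\<And>z. Im z > 0 \<Longrightarrow> ev f z = 0"
  shows "f = 0"
proof (rule ccontr)
  assume "f \<noteq> 0"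
  then have "map_poly complex_of_real f \<noteq> 0"
    by (simp add: map_poly_eq_0_iff)
  then have "finite {z. ev f z = 0}" by (rule poly_roots_finite)
  moreover have "range (\<lambda>k::nat. \<i> * of_nat (Suc k)) \<subseteq> {z. ev f z = 0}"
    using assms by auto
  moreover have "inj (\<lambda>k::nat. \<i> * of_nat (Suc k))"
    by (intro injI) (simp del: of_nat_Suc)
  ultimately show False
    using finite_subset range_inj_infinite by blast
qed

lemma poly_linear_factor_induct [consumes 1, case_names const linear]:
  fixes p :: "complex poly"
  assumes "p \<noteq> 0" "\<And>c. c \<noteq> 0 \<Longrightarrow> P [:c:]"
    "\<And>r q. q \<noteq> 0 \<Longrightarrow> P q \<Longrightarrow> P ([:- r, 1:] * q)"
  shows "P p"
  using assms(1)
proof (induction "degree p" arbitrary: p rule: less_induct)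
  case less
  show ?case
  proof (cases "degree p = 0")
    case True
    then obtain c where "p = [:c:]" by (rule degree_eq_zeroE)
    then show ?thesis using assms(2) less.prems by simp
  next
    case False
    then obtain r where "poly p r = 0"
      using alg_closed_imp_poly_has_root[of p] by auto
    then have "[:- r, 1:] dvd p" by (simp add: poly_eq_0_iff_dvd)
    then obtain q where q: "p = [:- r, 1:] * q" by (rule dvdE)
    then have "q \<noteq> 0" using less.prems by auto
    then have "degree p = Suc (degree q)" unfolding q by (subst degree_mult_eq) auto
    then have "P q" using less.hyps[of q] \<open>q \<noteq> 0\<close> by simp
    then show ?thesis unfolding q using assms(3) \<open>q \<noteq> 0\<close> by blast
  qed
qed

section \<open>Laguerre's theorem and the Grace-Walsh-Szego theorem\<close>

lemma cmod_cnj_diff_le: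
  assumes "Im w > 0" "Im r \<le> 0"
  shows "cmod (cnj w - r) \<le> cmod (w - r)"
proof (rule power2_le_imp_le)
  have "(cmod (w - r))\<^sup>2 - (cmod (cnj w - r))\<^sup>2 = - 4 * Im w * Im r"
    unfolding cmod_power2 by (simp add: power2_eq_square algebra_simps)
  moreover have "- 4 * Im w * Im r \<ge> 0" using assms by (simp add: mult_nonneg_nonpos)
  ultimately show "(cmod (cnj w - r))\<^sup>2 \<le> (cmod (w - r))\<^sup>2" by linarith
qed simp

lemma cmod_cnj_diff_less:
  assumes "Im w > 0" "Im r < 0"
  shows "cmod (cnj w - r) < cmod (w - r)"
proof (rule power2_less_imp_less)
  have "(cmod (w - r))\<^sup>2 - (cmod (cnj w - r))\<^sup>2 = 4 * (Im w * (- Im r))"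
    unfolding cmod_power2 by (simp add: power2_eq_square algebra_simps)
  moreover have "Im w * (- Im r) > 0" using assms by (intro mult_pos_pos) auto
  ultimately show "(cmod (cnj w - r))\<^sup>2 < (cmod (w - r))\<^sup>2" by linarith
qed simp

text \<open>With \<open>y = Im w\<close>, the map \<open>r \<mapsto> 1 / (w - r)\<close> sends the closed lower half-plane into the
  disc \<open>\<bar>s + \<i> / (2 y)\<bar> \<le> 1 / (2 y)\<close>; the logarithmic derivative of \<open>g\<close> at \<open>w\<close> is a sum of
  \<open>degree g\<close> such points.\<close>

lemma laguerre_disc:
  fixes g :: "complex poly"
  assumes "g \<noteq> 0" "\<And>z. Im z > 0 \<Longrightarrow> poly g z \<noteq> 0" and w: "Im w > 0"
  shows "cmod (of_real (2 * Im w) * poly (pderiv g) w + \<i> * of_nat (degree g) * poly g w)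
    \<le> real (degree g) * cmod (poly g w)"
  using assms(1,2)
proof (induction g rule: poly_linear_factor_induct)
  case (const c)
  then show ?case by (simp add: pderiv_pCons)
next
  case (linear r q)
  have "poly ([:- r, 1:] * q) r = 0" by simp
  then have r: "Im r \<le> 0" using linear.prems[of r] by linarith
  have q: "poly q z \<noteq> 0" if "Im z > 0" for z using linear.prems[OF that] by auto
  define y where "y = Im w"
  define G where "G = poly q w"
  define D where "D = poly (pderiv q) w"
  define d where "d = degree q"
  have IH: "cmod (of_real (2 * y) * D + \<i> * of_nat d * G) \<le> real d * cmod G"
    unfolding y_def D_def d_def G_def using linear.IH q by blast
  have deg: "degree ([:- r, 1:] * q) = Suc d"
    using linear.hyps unfolding d_def by (subst degree_mult_eq) auto
  have e1: "poly (pderiv ([:- r, 1:] * q)) w = G + (w - r) * D"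
    unfolding pderiv_mult G_def D_def by (simp add: pderiv_pCons algebra_simps)
  have e2: "poly ([:- r, 1:] * q) w = (w - r) * G"
    by (simp add: G_def algebra_simps)
  have y2: "of_real (2 * y) = - \<i> * (w - cnj w)"
    by (simp add: complex_eq_iff y_def)
  have "of_real (2 * y) * (G + (w - r) * D) + \<i> * of_nat (Suc d) * ((w - r) * G)
      = (w - r) * (of_real (2 * y) * D + \<i> * of_nat d * G) + G * (\<i> * (cnj w - r))"
    unfolding y2 by (simp add: algebra_simps)
  then have "cmod (of_real (2 * y) * (G + (w - r) * D) + \<i> * of_nat (Suc d) * ((w - r) * G))
      = cmod ((w - r) * (of_real (2 * y) * D + \<i> * of_nat d * G) + G * (\<i> * (cnj w - r)))"
    by (rule arg_cong)
  also have "\<dots> \<le> cmod (w - r) * (real d * cmod G) + cmod G * cmod (w - r)"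
  proof (intro norm_triangle_mono)
    show "cmod ((w - r) * (of_real (2 * y) * D + \<i> * of_nat d * G)) \<le> cmod (w - r) * (real d * cmod G)"
      unfolding norm_mult[of "w - r"] by (intro mult_left_mono IH) auto
    show "cmod (G * (\<i> * (cnj w - r))) \<le> cmod G * cmod (w - r)"
      unfolding norm_mult using cmod_cnj_diff_le[OF w r] by (simp add: mult_left_mono)
  qed
  also have "\<dots> = real (Suc d) * cmod ((w - r) * G)"
    unfolding norm_mult by (simp add: algebra_simps)
  finally show ?case unfolding deg e1 e2 y_def .
qed

text \<open>Count the \<open>n - degree g\<close> missing zeros as zeros at infinity: they
  contribute 0, which lies on the boundary of the disc of \<open>laguerre_disc\<close>. So
  \<open>g'/(n g)\<close> at \<open>w\<close> stays in that disc. A zero of the polar derivative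
  would make it equal to \<open>1/(w - \<xi>)\<close>, which lies outside for \<open>\<xi>\<close>
  in the upper half-plane.\<close>

lemma laguerre:
  fixes g :: "complex poly"
  assumes "\<And>z. Im z > 0 \<Longrightarrow> poly g z \<noteq> 0" and w: "Im w > 0" and x: "Im \<xi> > 0"
    and n: "degree g \<le> n" "n > 0"
  shows "of_nat n * poly g w + (\<xi> - w) * poly (pderiv g) w \<noteq> 0"
proof
  assume 0: "of_nat n * poly g w + (\<xi> - w) * poly (pderiv g) w = 0"
  have g: "poly g w \<noteq> 0" using assms(1) w by blast
  then have "g \<noteq> 0" by auto
  define y where "y = Im w"
  define d where "d = degree g"
  have "cmod (of_real (2 * y) * poly (pderiv g) w + \<i> * of_nat n * poly g w)
      = cmod ((of_real (2 * y) * poly (pderiv g) w + \<i> * of_nat d * poly g w)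
         + \<i> * of_nat (n - d) * poly g w)"
    using n unfolding d_def by (simp add: of_nat_diff algebra_simps)
  also have "\<dots> \<le> real d * cmod (poly g w) + real (n - d) * cmod (poly g w)"
    using laguerre_disc[OF \<open>g \<noteq> 0\<close> assms(1) w]
    by (intro norm_triangle_mono) (auto simp: norm_mult y_def d_def)
  also have "\<dots> = real n * cmod (poly g w)"
    using n unfolding d_def by (simp add: of_nat_diff algebra_simps)
  finally have le: "cmod (of_real (2 * y) * poly (pderiv g) w + \<i> * of_nat n * poly g w)
    \<le> real n * cmod (poly g w)" .
  have "of_real (2 * y) = - \<i> * (w - cnj w)"
    by (simp add: complex_eq_iff y_def)
  \<comment> \<open>Multiplying by \<open>w - \<xi>\<close> instead of dividing also covers
    \<open>\<xi> = w\<close>.\<close>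
  then have "(w - \<xi>) * (of_real (2 * y) * poly (pderiv g) w + \<i> * of_nat n * poly g w)
      = of_real (2 * y) * ((w - \<xi>) * poly (pderiv g) w) + (w - \<xi>) * (\<i> * of_nat n * poly g w)"
    by (simp add: algebra_simps)
  also have "(w - \<xi>) * poly (pderiv g) w = of_nat n * poly g w"
    using 0 by (simp add: algebra_simps)
  also have "of_real (2 * y) * (of_nat n * poly g w) + (w - \<xi>) * (\<i> * of_nat n * poly g w)
      = (\<i> * (cnj w - \<xi>)) * (of_nat n * poly g w)"
    unfolding \<open>of_real (2 * y) = _\<close> by (simp add: algebra_simps)
  finally have eq: "(w - \<xi>) * (of_real (2 * y) * poly (pderiv g) w + \<i> * of_nat n * poly g w)
      = (\<i> * (cnj w - \<xi>)) * (of_nat n * poly g w)" .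
  have "cmod (w - \<xi>) * cmod (of_real (2 * y) * poly (pderiv g) w + \<i> * of_nat n * poly g w)
      = cmod (cnj w - \<xi>) * (real n * cmod (poly g w))"
    using arg_cong[OF eq, of cmod] unfolding norm_mult by (simp only: norm_ii norm_of_nat mult_1)
  then have "cmod (cnj w - \<xi>) * (real n * cmod (poly g w)) \<le> cmod (w - \<xi>) * (real n * cmod (poly g w))"
    using mult_left_mono[OF le, of "cmod (w - \<xi>)"] by simp
  then have "cmod (cnj w - \<xi>) \<le> cmod (w - \<xi>)"
    using g n by (simp add: mult_le_cancel_right)
  moreover have "cmod (w - \<xi>) < cmod (cnj w - \<xi>)"
  proof -
    have "cmod (w - cnj \<xi>) = cmod (cnj w - \<xi>)" "cmod (cnj w - cnj \<xi>) = cmod (w - \<xi>)"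
      by (metis complex_cnj_cnj complex_cnj_diff complex_mod_cnj)+
    then show ?thesis using cmod_cnj_diff_less[of w "cnj \<xi>"] w x by simp
  qed
  ultimately show False by simp
qed

lemma sum_choose_Suc:
  fixes a :: "nat \<Rightarrow> 'a :: comm_ring_1"
  shows "(\<Sum>k\<le>Suc n. of_nat (Suc n choose k) * a k)
    = (\<Sum>k\<le>n. of_nat (n choose k) * a k) + (\<Sum>k\<le>n. of_nat (n choose k) * a (Suc k))"
proof -
  have "(\<Sum>k\<le>Suc n. of_nat (Suc n choose k) * a k)
      = a 0 + (\<Sum>k\<le>n. of_nat (Suc n choose Suc k) * a (Suc k))"
    by (subst sum.atMost_Suc_shift) simp
  also have "(\<Sum>k\<le>n. of_nat (Suc n choose Suc k) * a (Suc k))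
      = (\<Sum>k\<le>n. of_nat (n choose k) * a (Suc k)) + (\<Sum>k\<le>n. of_nat (n choose Suc k) * a (Suc k))"
    by (simp add: algebra_simps sum.distrib)
  also have "a 0 + \<dots> = (\<Sum>k\<le>n. of_nat (n choose k) * a (Suc k))
      + (\<Sum>k\<le>Suc n. of_nat (n choose k) * a k)"
    by (subst sum.atMost_Suc_shift) (simp add: algebra_simps)
  finally show ?thesis by (simp add: binomial_eq_0)
qed

text \<open>Peeling off one linear factor replaces the polynomial \<open>g\<close> in \<open>w\<close> by its polar derivative
  \<open>(n + 1) g + (x - w) g'\<close>, to which Laguerre's theorem applies.\<close>

lemma grace_walsh_szego:
  fixes c :: "nat \<Rightarrow> complex"
  assumes "\<And>w. Im w > 0 \<Longrightarrow> (\<Sum>k\<le>n. of_nat (n choose k) * (c k * w ^ (n - k))) \<noteq> 0"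
    "length xs = n" "\<forall>x\<in>set xs. Im x > 0"
  shows "(\<Sum>k\<le>n. coeff (\<Prod>x\<leftarrow>xs. [:x, 1:]) k * c k) \<noteq> 0"
  using assms
proof (induction n arbitrary: c xs)
  case 0
  from 0(1)[of \<i>] show ?case using 0(2) by simp
next
  case (Suc n)
  then obtain x ys where xs: "xs = x # ys" by (cases xs) auto
  define h where "h = (\<Prod>x\<leftarrow>ys. [:x, 1:])"
  have degh: "degree h \<le> n"
  proof -
    have "degree h \<le> length ys" unfolding h_def
    proof (induction ys)
      case (Cons y ys)
      have "degree ([:y, 1:] * (\<Prod>x\<leftarrow>ys. [:x, 1:])) \<le> 1 + length ys"
        using degree_mult_le[of "[:y,1:]" "\<Prod>x\<leftarrow>ys. [:x, 1:]"] Cons by simp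
      then show ?case by simp
    qed simp
    then show ?thesis using Suc.prems xs by simp
  qed
  \<comment> \<open>These weights are adjoint to multiplication by \<open>[:x, 1:]\<close>: the
    functional with weights \<open>c'\<close> at \<open>h\<close> equals the functional with weights
    \<open>c\<close> at \<open>[:x, 1:] * h\<close>.\<close>
  define c' where "c' k = c (Suc k) + x * c k" for k
  define g where "g = (\<Sum>k\<le>Suc n. monom (of_nat (Suc n choose k) * c k) (Suc n - k))"
  have g: "poly g w = (\<Sum>k\<le>Suc n. of_nat (Suc n choose k) * (c k * w ^ (Suc n - k)))" for w
    unfolding g_def by (simp add: poly_sum poly_monom algebra_simps)
  \<comment> \<open>Pascal's rule splits \<open>g\<close> as \<open>w U + V\<close>, and
    \<open>g' = (n + 1) U\<close>. The polar derivative of \<open>g\<close> at \<open>x\<close> is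
    thus \<open>(n + 1) (V + x U)\<close>, whose second factor is the polynomial belonging to
    \<open>c'\<close>.\<close>
  define U where "U w = (\<Sum>k\<le>n. of_nat (n choose k) * (c k * w ^ (n - k)))" for w
  define V where "V w = (\<Sum>k\<le>n. of_nat (n choose k) * (c (Suc k) * w ^ (n - k)))" for w
  have gUV: "poly g w = w * U w + V w" for w
  proof -
    have "(\<Sum>k\<le>n. of_nat (n choose k) * (c k * w ^ (Suc n - k))) = w * U w"
      unfolding U_def sum_distrib_left by (intro sum.cong) (auto simp: Suc_diff_le algebra_simps)
    then show ?thesis unfolding g sum_choose_Suc V_def by simp
  qed
  have absorb: "(Suc n - k) * (Suc n choose k) = Suc n * (n choose k)" for k
    using binomial_absorb_comp[of "Suc n" k] by simp
  have g': "poly (pderiv g) w = of_nat (Suc n) * U w" for w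
  proof -
    have "poly (pderiv g) w = (\<Sum>k\<le>Suc n. of_nat (Suc n - k) * (of_nat (Suc n choose k) * c k) * w ^ (n - k))"
      unfolding g_def higher_pderiv_sum[of 1, simplified] poly_sum pderiv_monom poly_monom
      by (intro sum.cong) simp_all
    also have "\<dots> = (\<Sum>k\<le>n. of_nat ((Suc n - k) * (Suc n choose k)) * (c k * w ^ (n - k)))"
      unfolding of_nat_mult by (simp add: mult_ac)
    also have "\<dots> = (\<Sum>k\<le>n. of_nat (Suc n * (n choose k)) * (c k * w ^ (n - k)))"
      by (intro sum.cong refl) (simp only: absorb atMost_iff)
    finally show ?thesis unfolding U_def sum_distrib_left by (simp add: algebra_simps)
  qed
  have degg: "degree g \<le> Suc n" unfolding g_def
    by (intro degree_sum_le) (auto intro: order.trans[OF degree_monom_le])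
  have "(\<Sum>k\<le>n. of_nat (n choose k) * (c' k * w ^ (n - k))) \<noteq> 0" if w: "Im w > 0" for w
  proof -
    have "of_nat (Suc n) * poly g w + (x - w) * poly (pderiv g) w \<noteq> 0"
      using Suc.prems xs degg w g by (intro laguerre) auto
    also have "of_nat (Suc n) * poly g w + (x - w) * poly (pderiv g) w
        = of_nat (Suc n) * (V w + x * U w)"
      unfolding g' gUV by (simp add: algebra_simps)
    also have "V w + x * U w = (\<Sum>k\<le>n. of_nat (n choose k) * (c' k * w ^ (n - k)))"
      unfolding U_def V_def c'_def by (simp add: sum_distrib_left algebra_simps sum.distrib)
    finally show ?thesis by simp
  qed
  then have "(\<Sum>k\<le>n. coeff h k * c' k) \<noteq> 0"
    unfolding h_def using Suc.prems xs by (intro Suc.IH) auto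
  also have "(\<Sum>k\<le>n. coeff h k * c' k)
      = (\<Sum>k\<le>n. coeff h k * c (Suc k)) + x * (\<Sum>k\<le>n. coeff h k * c k)"
    unfolding c'_def by (simp add: sum_distrib_left algebra_simps sum.distrib)
  also have "(\<Sum>k\<le>n. coeff h k * c k) = (\<Sum>k\<le>Suc n. coeff h k * c k)"
    using degh by (simp add: coeff_eq_0)
  also have "(\<Sum>k\<le>n. coeff h k * c (Suc k)) = (\<Sum>k\<le>Suc n. coeff (pCons 0 h) k * c k)"
    by (subst sum.atMost_Suc_shift) simp
  also have "\<dots> + x * (\<Sum>k\<le>Suc n. coeff h k * c k) = (\<Sum>k\<le>Suc n. coeff ([:x, 1:] * h) k * c k)"
    by (simp add: sum_distrib_left algebra_simps sum.distrib)
  finally show ?case unfolding h_def xs by simp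
qed

section \<open>Preservers from stable symbols\<close>

text \<open>Finitely many fixed entire functions with converging coefficients converge uniformly on
  compact sets, so Hurwitz's theorem applies: the limit has no zero in the half-plane unless it is
  constant there. A zero at \<open>z0\<close> and a nonzero value at \<open>z1\<close> would
  contradict this.\<close>

lemma hurwitz_combination:
  fixes \<phi> :: "nat \<Rightarrow> complex \<Rightarrow> complex" and a :: "nat \<Rightarrow> nat \<Rightarrow> complex"
  assumes hol: "\<And>k. \<phi> k holomorphic_on UNIV" and lim: "\<And>k. (\<lambda>m. a m k) \<longlonglongrightarrow> b k"
    and nz: "\<And>m z. Im z > 0 \<Longrightarrow> (\<Sum>k\<le>n. a m k * \<phi> k z) \<noteq> 0"
    and z0: "Im z0 > 0" "(\<Sum>k\<le>n. b k * \<phi> k z0) = 0" and z1: "Im z1 > 0"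
  shows "(\<Sum>k\<le>n. b k * \<phi> k z1) = 0"
proof (rule ccontr)
  assume nonzero: "(\<Sum>k\<le>n. b k * \<phi> k z1) \<noteq> 0"
  have "(\<Sum>k\<le>n. b k * \<phi> k z0) \<noteq> 0"
  proof (rule Hurwitz_no_zeros[where S = "{z. Im z > 0}"
        and \<F> = "\<lambda>m z. \<Sum>k\<le>n. a m k * \<phi> k z" and g = "\<lambda>z. \<Sum>k\<le>n. b k * \<phi> k z"])
    show "open {z. Im z > 0}" by (rule open_halfspace_Im_gt)
    show "connected {z. Im z > 0}" by (intro convex_connected convex_halfspace_Im_gt)
    have hol': "\<phi> k holomorphic_on S" for k S
      using hol holomorphic_on_subset by blast
    show "(\<lambda>z. \<Sum>k\<le>n. a m k * \<phi> k z) holomorphic_on {z. Im z > 0}" for m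
      by (intro holomorphic_intros hol')
    show "(\<lambda>z. \<Sum>k\<le>n. b k * \<phi> k z) holomorphic_on {z. Im z > 0}"
      by (intro holomorphic_intros hol')
    show "\<not> (\<lambda>z. \<Sum>k\<le>n. b k * \<phi> k z) constant_on {z. Im z > 0}"
      using z0 z1 nonzero unfolding constant_on_def by force
    show "uniform_limit K (\<lambda>m z. \<Sum>k\<le>n. a m k * \<phi> k z) (\<lambda>z. \<Sum>k\<le>n. b k * \<phi> k z) sequentially"
      if "compact K" for K
    proof -
      have "uniform_limit K (\<lambda>m z. a m k * \<phi> k z) (\<lambda>z. b k * \<phi> k z) sequentially" for k
      proof (rule uniform_lim_mult)
        show "uniform_limit K (\<lambda>m z. a m k) (\<lambda>z. b k) sequentially"
        using lim[of k] by (auto intro!: uniform_limitI simp: tendsto_iff elim: eventually_mono)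
        show "uniform_limit K (\<lambda>m. \<phi> k) (\<phi> k) sequentially"
          by (rule uniform_limit_const)
        show "bounded ((\<lambda>z. b k) ` K)"
        by (rule bounded_subset[of "{b k}"]) auto
        show "bounded (\<phi> k ` K)"
          using hol'[of k K] that
          by (intro compact_imp_bounded compact_continuous_image holomorphic_on_imp_continuous_on)
      qed
      then show ?thesis
        by (induction n) (simp_all add: uniform_limit_add)
    qed
  qed (use nz z0 in auto)
  then show False using z0 by simp
qed

lemma tendsto_coeff_mult:
  fixes p q :: "nat \<Rightarrow> complex poly"
  assumes "\<And>k. (\<lambda>m. coeff (p m) k) \<longlonglongrightarrow> coeff p' k" "\<And>k. (\<lambda>m. coeff (q m) k) \<longlonglongrightarrow> coeff q' k"
  shows "(\<lambda>m. coeff (p m * q m) k) \<longlonglongrightarrow> coeff (p' * q') k"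
  unfolding coeff_mult by (intro tendsto_intros assms)

lemma tendsto_coeff_linear:
  assumes "a \<longlonglongrightarrow> a'" "b \<longlonglongrightarrow> b'"
  shows "(\<lambda>m. coeff [:a m, b m:] k) \<longlonglongrightarrow> coeff [:a', b':] k"
  using assms by (auto simp: coeff_pCons split: nat.splits)

lemma tendsto_coeff_prod_list:
  fixes p :: "nat \<Rightarrow> 'b \<Rightarrow> complex poly"
  assumes "\<And>x k. (\<lambda>m. coeff (p m x) k) \<longlonglongrightarrow> coeff (p' x) k"
  shows "(\<lambda>m. coeff (\<Prod>x\<leftarrow>xs. p m x) k) \<longlonglongrightarrow> coeff (\<Prod>x\<leftarrow>xs. p' x) k"
proof (induction xs arbitrary: k)
  case (Cons x xs)
  then show ?case by (simp add: tendsto_coeff_mult assms)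
qed simp

lemma prod_list_insort:
  fixes g :: "'a :: linorder \<Rightarrow> 'b :: comm_monoid_mult"
  shows "(\<Prod>x\<leftarrow>insort a xs. g x) = g a * (\<Prod>x\<leftarrow>xs. g x)"
  by (induction xs) (auto simp: mult.left_commute)

lemma hyperbolic_factor:
  assumes "hyperbolic f"
  shows "\<exists>xs. is_zero_list f xs \<and> length xs = degree f"
  using assms
proof (induction "degree f" arbitrary: f)
  case 0
  then obtain c where "f = [:c:]" by (metis degree_eq_zeroE)
  then show ?case unfolding is_zero_list_def by (intro exI[of _ "[]"]) auto
next
  case (Suc d)
  have "degree (map_poly complex_of_real f) \<noteq> 0"
    using Suc.hyps(2) by (simp add: degree_map_poly)
  then obtain z where z: "ev f z = 0"
    using alg_closed_imp_poly_has_root[of "map_poly complex_of_real f"] by auto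
  then have "Im z = 0" using Suc.prems unfolding hyperbolic_def by blast
  then have "z = of_real (Re z)" by (simp add: complex_eq_iff)
  then have "of_real (poly f (Re z)) = (0 :: complex)"
    using z by (metis ev_of_real)
  then have "[:- Re z, 1:] dvd f" by (simp add: poly_eq_0_iff_dvd)
  then obtain g where g: "f = [:- Re z, 1:] * g" by (rule dvdE)
  have "g \<noteq> 0" using Suc.hyps(2) unfolding g by auto
  then have deg: "degree f = Suc (degree g)" unfolding g by (subst degree_mult_eq) auto
  have "hyperbolic g"
    using Suc.prems unfolding hyperbolic_iff g ev_mult by auto
  then obtain xs where xs: "is_zero_list g xs" "length xs = degree g"
    using Suc.hyps(1)[of g] Suc.hyps(2) deg by auto
  have "[:- Re z, 1:] * g = smult (lead_coeff g) ([:- Re z, 1:] * (\<Prod>x\<leftarrow>xs. [:- x, 1:]))"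
    using xs(1) unfolding is_zero_list_def by (metis mult_smult_right)
  moreover have "(\<Prod>x\<leftarrow>insort (Re z) xs. [:- x, 1:]) = [:- Re z, 1:] * (\<Prod>x\<leftarrow>xs. [:- x, 1:])"
    by (rule prod_list_insort)
  moreover have "lead_coeff f = lead_coeff g" unfolding g lead_coeff_mult by simp
  ultimately have "is_zero_list f (insort (Re z) xs)"
    using xs(1) g unfolding is_zero_list_def by (simp only: sorted_insort)
  then show ?case using xs(2) deg by (intro exI[of _ "insort (Re z) xs"]) simp
qed

lemma coeff_prod_list_of_real:
  "coeff (\<Prod>x\<leftarrow>xs. [:- complex_of_real x, 1:]) k = of_real (coeff (\<Prod>x\<leftarrow>xs. [:- x, 1:]) k)"
proof (induction xs arbitrary: k)
  case (Cons x xs)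
  have eq: "coeff ([:- a, 1:] * p) k = (case k of 0 \<Rightarrow> 0 | Suc j \<Rightarrow> coeff p j) - a * coeff p k"
    for a :: "'a :: comm_ring_1" and p
    by (simp add: coeff_pCons split: nat.splits)
  show ?case unfolding list.map prod_list.Cons eq by (simp add: Cons.IH split: nat.splits)
qed simp

text \<open>Stated for an arbitrary family \<open>\<tau> k\<close> in place of
  \<open>T(z^k)\<close>, so that the signs needed for condition (c) can be absorbed into
  \<open>\<tau>\<close>.\<close>

lemma stable_symbol_imp_preserver:
  fixes \<tau> :: "nat \<Rightarrow> real poly"
  assumes stable: "\<And>z w. Im z > 0 \<Longrightarrow> Im w > 0 \<Longrightarrow>
      (\<Sum>k\<le>n. of_nat (n choose k) * (ev (\<tau> k) z * w ^ (n - k))) \<noteq> 0"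
    and f: "hyperbolic f" "degree f \<le> n"
  shows "hyperbolic (\<Sum>k\<le>n. smult (coeff f k) (\<tau> k)) \<or> (\<Sum>k\<le>n. smult (coeff f k) (\<tau> k)) = 0"
proof -
  obtain xs where xs: "is_zero_list f xs" and len: "length xs = degree f"
    using hyperbolic_factor[OF f(1)] by blast
  have f0: "f \<noteq> 0" using f by (simp add: hyperbolic_def)
  define \<epsilon> where "\<epsilon> m = inverse (real (Suc m))" for m
  have \<epsilon>: "\<epsilon> m > 0" for m unfolding \<epsilon>_def by simp
  have \<epsilon>0: "(\<lambda>m. complex_of_real (\<epsilon> m)) \<longlonglongrightarrow> 0"
    using tendsto_of_real[OF LIMSEQ_inverse_real_of_nat, where 'a = complex]
    unfolding \<epsilon>_def by (simp only: of_real_0)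
  define d where "d = n - degree f"
  \<comment> \<open>Perturbing \<open>f\<close> moves its zeros into the open lower half-plane and raises its degree to \<open>n\<close>.\<close>
  define h where "h m = smult (of_real (lead_coeff f)) ((\<Prod>x\<leftarrow>xs. [:- of_real x + \<i> * \<epsilon> m, 1:])
      * (\<Prod>x\<leftarrow>replicate d (). [:1, - \<i> * \<epsilon> m:]))" for m
  have lim: "(\<lambda>m. coeff (h m) k) \<longlonglongrightarrow> of_real (coeff f k)" for k
  proof -
    have "(\<lambda>m. coeff ((\<Prod>x\<leftarrow>xs. [:- of_real x + \<i> * \<epsilon> m, 1:])
      * (\<Prod>x\<leftarrow>replicate d (). [:1, - \<i> * \<epsilon> m:])) k) \<longlonglongrightarrow>
      coeff ((\<Prod>x\<leftarrow>xs. [:- of_real x + \<i> * 0, 1:]) * (\<Prod>x\<leftarrow>replicate d (). [:1, - \<i> * 0:])) k"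
      by (intro tendsto_coeff_mult tendsto_coeff_prod_list tendsto_coeff_linear tendsto_intros \<epsilon>0)
    also have "(\<Prod>x\<leftarrow>replicate d (). [:1, - \<i> * 0:]) = (1 :: complex poly)"
      by (induction d) auto
    finally have "(\<lambda>m. coeff ((\<Prod>x\<leftarrow>xs. [:- of_real x + \<i> * \<epsilon> m, 1:])
      * (\<Prod>x\<leftarrow>replicate d (). [:1, - \<i> * \<epsilon> m:])) k) \<longlonglongrightarrow>
      coeff (\<Prod>x\<leftarrow>xs. [:- of_real x, 1:]) k"
      by (simp only: mult_zero_right add_0_right mult_1_right)
    then have "(\<lambda>m. of_real (lead_coeff f) * coeff ((\<Prod>x\<leftarrow>xs. [:- of_real x + \<i> * \<epsilon> m, 1:])
      * (\<Prod>x\<leftarrow>replicate d (). [:1, - \<i> * \<epsilon> m:])) k) \<longlonglongrightarrow>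
      of_real (lead_coeff f) * coeff (\<Prod>x\<leftarrow>xs. [:- of_real x, 1:]) k"
      by (rule tendsto_mult_left)
    moreover have "coeff (\<Prod>x\<leftarrow>xs. [:- complex_of_real x, 1:]) k = of_real (coeff (\<Prod>x\<leftarrow>xs. [:- x, 1:]) k)"
      using coeff_prod_list_of_real .
    moreover have "coeff f k = lead_coeff f * coeff (\<Prod>x\<leftarrow>xs. [:- x, 1:]) k"
      using xs unfolding is_zero_list_def by (metis coeff_smult)
    ultimately show ?thesis unfolding h_def coeff_smult by (simp only: of_real_mult)
  qed
  have nz: "(\<Sum>k\<le>n. coeff (h m) k * ev (\<tau> k) z) \<noteq> 0" if z: "Im z > 0" for m z
  proof -
    define ys where "ys = map (\<lambda>x. - of_real x + \<i> * \<epsilon> m) xs @ replicate d (\<i> / \<epsilon> m)"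
    define c where "c = of_real (lead_coeff f) * (- \<i> * \<epsilon> m) ^ d"
    \<comment> \<open>A padding factor tends to 1 while its zero
      \<open>- \<i> / \<epsilon> m\<close> escapes to infinity inside the lower half-plane. It is
      made monic here because \<open>grace_walsh_szego\<close> speaks of factors
      \<open>[:x, 1:]\<close>.\<close>
    have "[:1, - \<i> * \<epsilon> m:] = smult (- \<i> * \<epsilon> m) [:\<i> / \<epsilon> m, 1:]"
      using \<epsilon>[of m] by simp
    then have "(\<Prod>x\<leftarrow>replicate d (). [:1, - \<i> * \<epsilon> m:])
      = smult ((- \<i> * \<epsilon> m) ^ d) (\<Prod>x\<leftarrow>replicate d (\<i> / \<epsilon> m). [:x, 1:])"
      by (simp only: map_replicate prod_list_replicate smult_power)
    then have h: "h m = smult c (\<Prod>y\<leftarrow>ys. [:y, 1:])"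
      unfolding h_def ys_def c_def map_append prod_list.append map_map comp_def
      by (simp only: mult_smult_right smult_smult)
    have "(\<Sum>k\<le>n. coeff (\<Prod>y\<leftarrow>ys. [:y, 1:]) k * ev (\<tau> k) z) \<noteq> 0"
    proof (rule grace_walsh_szego)
      show "length ys = n" using len f(2) unfolding ys_def d_def by simp
      show "\<forall>y\<in>set ys. 0 < Im y" unfolding ys_def using \<epsilon>[of m] by auto
    qed (rule stable[OF z])
    moreover have "c \<noteq> 0" unfolding c_def using f0 \<epsilon>[of m] by auto
    moreover have "(\<Sum>k\<le>n. coeff (h m) k * ev (\<tau> k) z)
        = c * (\<Sum>k\<le>n. coeff (\<Prod>y\<leftarrow>ys. [:y, 1:]) k * ev (\<tau> k) z)"
      unfolding h by (simp add: sum_distrib_left mult.assoc)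
    ultimately show ?thesis by simp
  qed
  have ev_eq: "ev (\<Sum>k\<le>n. smult (coeff f k) (\<tau> k)) z = (\<Sum>k\<le>n. of_real (coeff f k) * ev (\<tau> k) z)" for z
    by (simp only: ev_sum ev_smult)
  show ?thesis
  proof (cases "hyperbolic (\<Sum>k\<le>n. smult (coeff f k) (\<tau> k))")
    case False
    then obtain z0 where z0: "Im z0 > 0" "ev (\<Sum>k\<le>n. smult (coeff f k) (\<tau> k)) z0 = 0"
      unfolding hyperbolic_iff by blast
    have "(\<Sum>k\<le>n. smult (coeff f k) (\<tau> k)) = 0"
    proof (rule eq_0_if_ev_upper_0)
      fix z :: complex assume "Im z > 0"
      then show "ev (\<Sum>k\<le>n. smult (coeff f k) (\<tau> k)) z = 0"
        unfolding ev_eq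
        using hurwitz_combination[OF ev_holomorphic lim nz z0(1) z0(2)[unfolded ev_eq]] by blast
    qed
    then show ?thesis ..
  qed simp
qed

section \<open>Interlacing zeros and arguments\<close>

text \<open>For \<open>Im z > 0\<close> this is the argument of \<open>z - x\<close>, in
  \<open>(0, pi)\<close>. The arctan form makes continuity in \<open>z\<close>, monotonicity in
  \<open>x\<close> and the limits at the real axis immediate.\<close>

definition angle :: "complex \<Rightarrow> real \<Rightarrow> real" where
  "angle z x = pi / 2 + arctan ((x - Re z) / Im z)"

lemma angle_bounds: "0 < angle z x" "angle z x < pi"
  using arctan_bounded[of "(x - Re z) / Im z"] unfolding angle_def by auto

lemma angle_mono: "Im z > 0 \<Longrightarrow> x \<le> y \<Longrightarrow> angle z x \<le> angle z y"
  unfolding angle_def by (simp add: divide_right_mono arctan_le_iff)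

lemma angle_inj: "Im z > 0 \<Longrightarrow> angle z x = angle z y \<longleftrightarrow> x = y"
  unfolding angle_def by (simp add: arctan_eq_iff)

lemma diff_eq_cis_angle:
  assumes "Im z > 0"
  shows "\<exists>R>0. z - of_real x = of_real R * cis (angle z x)"
proof -
  define t where "t = (x - Re z) / Im z"
  define R where "R = Im z * sqrt (1 + t\<^sup>2)"
  have pos: "sqrt (1 + t\<^sup>2) > 0" by (simp add: sum_power2_gt_zero_iff add_pos_nonneg)
  have "cos (angle z x) = - (t / sqrt (1 + t\<^sup>2))" "sin (angle z x) = 1 / sqrt (1 + t\<^sup>2)"
    unfolding angle_def t_def by (simp_all add: cos_add sin_add sin_arctan cos_arctan)
  then have "R * cos (angle z x) = Re z - x" "R * sin (angle z x) = Im z"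
    using pos assms unfolding R_def t_def by (simp_all add: field_simps)
  then have "z - of_real x = of_real R * cis (angle z x)"
    by (simp add: complex_eq_iff)
  moreover have "R > 0" using assms pos unfolding R_def by simp
  ultimately show ?thesis by blast
qed

lemma ev_eq_cis_angles:
  assumes "is_zero_list f xs" "Im z > 0"
  shows "\<exists>R>0. ev f z = of_real (lead_coeff f * R) * cis (\<Sum>x\<leftarrow>xs. angle z x)"
proof -
  have "\<exists>R>0. ev (\<Prod>x\<leftarrow>xs. [:- x, 1:]) z = of_real R * cis (\<Sum>x\<leftarrow>xs. angle z x)"
  proof (induction xs)
    case Nil
    then show ?case by (intro exI[of _ 1]) simp
  next
    case (Cons x xs)
    then obtain R where R: "R > 0" "ev (\<Prod>x\<leftarrow>xs. [:- x, 1:]) z = of_real R * cis (\<Sum>x\<leftarrow>xs. angle z x)"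
      by blast
    obtain R' where R': "R' > 0" "z - of_real x = of_real R' * cis (angle z x)"
      using diff_eq_cis_angle[OF assms(2)] by blast
    have "ev (\<Prod>x\<leftarrow>x # xs. [:- x, 1:]) z = (z - of_real x) * ev (\<Prod>x\<leftarrow>xs. [:- x, 1:]) z"
      unfolding list.map prod_list.Cons ev_mult ev_linear by simp
    also have "\<dots> = of_real (R' * R) * cis (angle z x + (\<Sum>x\<leftarrow>xs. angle z x))"
      unfolding R R' cis_mult[symmetric] of_real_mult by (simp only: mult_ac)
    finally show ?case using R(1) R'(1) by (intro exI[of _ "R' * R"]) simp
  qed
  then obtain R where "R > 0" "ev (\<Prod>x\<leftarrow>xs. [:- x, 1:]) z = of_real R * cis (\<Sum>x\<leftarrow>xs. angle z x)"
    by blast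
  moreover have "ev f z = of_real (lead_coeff f) * ev (\<Prod>x\<leftarrow>xs. [:- x, 1:]) z"
    using assms(1) unfolding is_zero_list_def by (metis ev_smult)
  ultimately show ?thesis by (intro exI[of _ R]) simp
qed

text \<open>The product with the conjugate has the argument of the quotient of \<open>P\<close> and
  \<open>Q\<close>. Only the vanishing of the imaginary part is compared, so the signs of the
  leading coefficients do no harm.\<close>

lemma Im_ev_quotient:
  assumes "is_zero_list P xs" "is_zero_list Q ys" "Im z > 0" "P \<noteq> 0" "Q \<noteq> 0"
  shows "Im (ev P z * cnj (ev Q z)) = 0 \<longleftrightarrow>
    sin ((\<Sum>x\<leftarrow>xs. angle z x) - (\<Sum>y\<leftarrow>ys. angle z y)) = 0"
proof -
  obtain R where R: "R > 0" "ev P z = of_real (lead_coeff P * R) * cis (\<Sum>x\<leftarrow>xs. angle z x)"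
    using ev_eq_cis_angles assms by blast
  obtain S where S: "S > 0" "ev Q z = of_real (lead_coeff Q * S) * cis (\<Sum>y\<leftarrow>ys. angle z y)"
    using ev_eq_cis_angles assms by blast
  have "ev P z * cnj (ev Q z) = of_real (lead_coeff P * R * (lead_coeff Q * S)) *
      cis ((\<Sum>x\<leftarrow>xs. angle z x) - (\<Sum>y\<leftarrow>ys. angle z y))"
    unfolding R S complex_cnj_mult cis_cnj complex_cnj_complex_of_real diff_conv_add_uminus[of "sum_list (map (angle z) xs)"]
      cis_mult[symmetric] of_real_mult by (simp only: mult_ac)
  then show ?thesis using R(1) S(1) assms(4,5) by simp
qed

text \<open>The length conditions make the two lists alternate up to the end, so the nested
  subtraction gives entries of \<open>xs\<close> the sign plus and entries of \<open>ys\<close> the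
  sign minus.\<close>

lemma interleave_angle_sum:
  "(\<Sum>x\<leftarrow>xs. angle z x) - (\<Sum>y\<leftarrow>ys. angle z y) = foldr (\<lambda>u s. angle z u - s) (interleave xs ys) 0"
  if "length ys \<le> length xs" "length xs \<le> length ys + 1"
  using that
proof (induction xs ys rule: interleave.induct)
  case (2 x xs ys)
  then show ?case by (cases "length ys \<le> length (x # xs)") auto
qed simp

text \<open>Bounds in terms of the first angle make the induction work: prepending \<open>u\<close>
  replaces \<open>A\<close> by \<open>angle z u - A\<close>, and \<open>angle z u\<close> is at most
  the previous first angle. What matters later is that the absolute value of \<open>A\<close> is
  below \<open>pi\<close>.\<close>

lemma alternating_angle_sum:
  assumes "Im z > 0" "sorted us" "us \<noteq> []"
  defines "A \<equiv> foldr (\<lambda>u s. angle z u - s) us 0"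
  shows "(odd (length us) \<longrightarrow> angle z (hd us) \<le> A \<and> A < pi) \<and>
    (even (length us) \<longrightarrow> angle z (hd us) - pi < A \<and> A \<le> 0)"
  using assms(2,3) unfolding A_def
proof (induction us)
  case (Cons u us)
  show ?case
  proof (cases us)
    case Nil
    then show ?thesis using angle_bounds[of z u] by simp
  next
    case (Cons v vs)
    then have "angle z u \<le> angle z v" using Cons.prems angle_mono[OF assms(1)] by simp
    then show ?thesis using Cons.IH Cons.prems Cons angle_bounds[of z u] angle_bounds[of z v]
      by (auto split: if_splits)
  qed
qed simp

text \<open>An odd number of terms gives a sum of at least the first angle, which is positive. With
  an even number, each consecutive pair contributes a nonpositive amount, so a zero sum forces the
  two members of every pair to coincide.\<close>

lemma interleave_eq_if_alternating_angle_sum_0: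
  assumes "Im z > 0" "sorted (interleave xs ys)" "length ys \<le> length xs" "length xs \<le> length ys + 1"
    "foldr (\<lambda>u s. angle z u - s) (interleave xs ys) 0 = 0"
  shows "xs = ys"
  using assms(2-)
proof (induction xs arbitrary: ys)
  case (Cons x xs)
  show ?case
  proof (cases ys)
    case Nil
    then show ?thesis using Cons.prems angle_bounds[of z x] by simp
  next
    case [simp]: (Cons y ys')
    let ?A = "foldr (\<lambda>u s. angle z u - s) (interleave xs ys') 0"
    have eq: "angle z x - angle z y + ?A = 0" using Cons.prems(4) by simp
    have sorted: "sorted (interleave xs ys')" "x \<le> y" using Cons.prems(1) by auto
    have le: "angle z x \<le> angle z y" using angle_mono[OF assms(1) sorted(2)] .
    have "?A \<le> 0"
    proof (cases "even (length (interleave xs ys'))")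
      case True
      then show ?thesis
        using alternating_angle_sum[OF assms(1) sorted(1)] by (cases "interleave xs ys' = []") auto
    next
      case False
      have "odd (length (interleave (x # xs) ys))" using False by simp
      then have "angle z x \<le> foldr (\<lambda>u s. angle z u - s) (interleave (x # xs) ys) 0"
        using alternating_angle_sum[OF assms(1) Cons.prems(1)] by simp
      then show ?thesis using Cons.prems(4) angle_bounds[of z x] by linarith
    qed
    then have "angle z x = angle z y" "?A = 0" using eq le by linarith+
    then show ?thesis
      using angle_inj[OF assms(1)] Cons.IH[OF sorted(1)] Cons.prems by simp
  qed
qed simp

lemma interlace_from_Im_nonzero:
  assumes "is_zero_list P xs" "is_zero_list Q ys" "interlace_from xs ys" "P \<noteq> 0" "Q \<noteq> 0"
    and z: "Im z > 0" and 0: "Im (ev P z * cnj (ev Q z)) = 0"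
  shows "xs = ys"
proof -
  let ?us = "interleave xs ys"
  have len: "length ys \<le> length xs" "length xs \<le> length ys + 1" and sorted: "sorted ?us"
    using assms(3) unfolding interlace_from_def by auto
  define A where "A = foldr (\<lambda>u s. angle z u - s) ?us 0"
  have "sin A = 0"
    using Im_ev_quotient[OF assms(1,2) z assms(4,5)] 0 interleave_angle_sum[OF len] unfolding A_def
    by simp
  moreover have "- pi < A \<and> A < pi"
  proof (cases "?us = []")
    case False
    then show ?thesis
      using alternating_angle_sum[OF z sorted] angle_bounds[of z "hd ?us"] unfolding A_def
      by (cases "even (length ?us)") auto
  qed (simp add: A_def)
  ultimately have "A = 0" by (meson sin_eq_0_pi)
  then show ?thesis
    using interleave_eq_if_alternating_angle_sum_0[OF z sorted len] unfolding A_def by blast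
qed

lemma degree_le_1_eq: "degree f \<le> 1 \<Longrightarrow> \<exists>c d. f = [:c, d:]"
  by (intro exI[of _ "coeff f 0"] exI[of _ "coeff f 1"] poly_eqI)
    (auto simp: coeff_pCons coeff_eq_0 split: nat.splits)

text \<open>A zero of \<open>a P + b Q\<close> in the upper half-plane makes the quotient of
  \<open>P\<close> and \<open>Q\<close> real there. Interlacing then forces equal zero lists, so the
  combination is a real multiple of a product without zeros in that half-plane. Degrees at most 1,
  where interlacing is a convention, are treated directly.\<close>

lemma interlacing_pencil:
  assumes "hyperbolic P" "hyperbolic Q" "zeros_interlace P Q"
  shows "hyperbolic (smult a P + smult b Q) \<or> smult a P + smult b Q = 0"
proof (rule disjCI)
  let ?f = "smult a P + smult b Q"
  assume nz: "?f \<noteq> 0"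
  have PQ: "P \<noteq> 0" "Q \<noteq> 0" using assms by (auto simp: hyperbolic_def)
  show "hyperbolic ?f" unfolding hyperbolic_iff
  proof (intro allI impI notI)
    fix z assume z: "Im z > 0" and "ev ?f z = 0"
    then have 0: "of_real a * ev P z + of_real b * ev Q z = 0"
      unfolding ev_add ev_smult by simp
    show False
    proof (cases "degree P \<le> 1 \<and> degree Q \<le> 1")
      case True
      then have "degree ?f \<le> 1" by (intro degree_add_le) (auto intro: order.trans[OF degree_smult_le])
      then obtain c d where f: "?f = [:c, d:]"
        using degree_le_1_eq by blast
      then have "of_real c + z * of_real d = 0"
        using \<open>ev ?f z = 0\<close> unfolding f by (simp add: map_poly_pCons)
      then have "c = 0" "d = 0" using z by (auto simp: complex_eq_iff)
      then show False using f nz by simp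
    next
      case False
      then obtain xs ys where xy: "is_zero_list P xs" "is_zero_list Q ys"
          "interlace_from xs ys \<or> interlace_from ys xs"
        using assms(3) unfolding zeros_interlace_def by blast
      have "ev P z \<noteq> 0" "ev Q z \<noteq> 0" using assms z unfolding hyperbolic_iff by auto
      have "a \<noteq> 0 \<or> b \<noteq> 0" using nz by auto
      have "Im (ev P z * cnj (ev Q z)) = 0"
      proof -
        have "of_real a * (ev P z * cnj (ev Q z)) + of_real b * (ev Q z * cnj (ev Q z)) = 0"
          "of_real a * (ev P z * cnj (ev P z)) + of_real b * (ev Q z * cnj (ev P z)) = 0"
          using 0 by (simp_all flip: mult.assoc distrib_right)
        then have "a * Im (ev P z * cnj (ev Q z)) = 0" "b * Im (ev Q z * cnj (ev P z)) = 0"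
          by (simp_all add: complex_eq_iff)
        then show ?thesis using \<open>a \<noteq> 0 \<or> b \<noteq> 0\<close> by (auto simp: algebra_simps)
      qed
      moreover from this have "Im (ev Q z * cnj (ev P z)) = 0" by (simp add: algebra_simps)
      ultimately have "xs = ys"
        using interlace_from_Im_nonzero[OF xy(1,2) _ PQ z] interlace_from_Im_nonzero[OF xy(2,1) _ PQ(2,1) z] xy(3)
        by blast
      define D where "D = (\<Prod>x\<leftarrow>xs. [:- x, 1:])"
      have "P = smult (lead_coeff P) D" "Q = smult (lead_coeff Q) D"
        using xy(1,2) \<open>xs = ys\<close> unfolding is_zero_list_def D_def by auto
      then have f: "?f = smult (a * lead_coeff P + b * lead_coeff Q) D"
        by (metis smult_smult smult_add_left)
      have "ev D z \<noteq> 0" using \<open>P = _\<close> \<open>ev P z \<noteq> 0\<close> by (metis ev_smult mult_zero_right)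
      moreover have "of_real (a * lead_coeff P + b * lead_coeff Q) * ev D z = 0"
        using \<open>ev ?f z = 0\<close> unfolding f ev_smult .
      ultimately show False using nz f by (metis mult_eq_0_iff of_real_eq_0_iff smult_0_left)
    qed
  qed
qed

section \<open>Interlacing from boundary values of the argument\<close>

lemma interlace_from_if_counts:
  assumes "sorted xs" "sorted ys"
    "\<And>t. length (filter (\<lambda>y. y \<le> t) ys) \<le> length (filter (\<lambda>x. x \<le> t) xs)"
    "\<And>t. length (filter (\<lambda>x. x \<le> t) xs) \<le> length (filter (\<lambda>y. y \<le> t) ys) + 1"
  shows "interlace_from xs ys"
  using assms
proof (induction xs ys rule: interleave.induct)
  case (1 ys)
  have "ys = []"
  proof (rule ccontr)
    assume "ys \<noteq> []"
    then show False using 1(3)[of "hd ys"] by (cases ys) auto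
  qed
  then show ?case unfolding interlace_from_def by simp
next
  case (2 x xs ys)
  have le: "x \<le> y" if "y \<in> set ys" for y
  proof (rule ccontr)
    assume "\<not> x \<le> y"
    then have "filter (\<lambda>x. x \<le> y) (x # xs) = []"
      using 2(2) by (auto simp: filter_empty_conv)
    moreover have "filter (\<lambda>x. x \<le> y) ys \<noteq> []"
      using that by (auto simp: filter_empty_conv)
    ultimately show False using 2(4)[of y] by (metis le_zero_eq length_0_conv list.size(3))
  qed
  \<comment> \<open>Removing the smallest entry \<open>x\<close> lowers the count of the first list
    by one from \<open>x\<close> on, and left of \<open>x\<close> both counts are 0. This swaps the
    roles of the lists, exactly as \<open>interleave\<close> does.\<close>
  have "interlace_from ys xs"
  proof (rule "2.IH")
    show "sorted ys" "sorted xs" using 2 by auto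
    fix t
    show "length (filter (\<lambda>x. x \<le> t) xs) \<le> length (filter (\<lambda>y. y \<le> t) ys)"
    proof (cases "x \<le> t")
      case True
      then show ?thesis using 2(5)[of t] by simp
    next
      case False
      then have "filter (\<lambda>x. x \<le> t) xs = []" using 2(2) by (auto simp: filter_empty_conv)
      then show ?thesis by simp
    qed
    show "length (filter (\<lambda>y. y \<le> t) ys) \<le> length (filter (\<lambda>x. x \<le> t) xs) + 1"
      using 2(4)[of t] by (auto split: if_splits)
  qed
  moreover have "set (interleave ys xs) = set ys \<union> set xs"
    by (induction ys xs rule: interleave.induct) auto
  ultimately show ?case using le 2(2) unfolding interlace_from_def by auto
qed

lemma angle_tendsto:
  assumes "x \<noteq> t"
  shows "((\<lambda>e. angle (Complex t e) x) \<longlongrightarrow> (if x \<le> t then 0 else pi)) (at_right 0)"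
proof (cases "x \<le> t")
  case True
  then have "filterlim (\<lambda>e. (x - t) / e) at_bot (at_right (0::real))"
    using assms unfolding divide_inverse
    by (intro filterlim_tendsto_neg_mult_at_bot[OF tendsto_const] filterlim_inverse_at_top_right) auto
  then have "((\<lambda>e. pi / 2 + arctan ((x - t) / e)) \<longlongrightarrow> pi / 2 + (- (pi / 2))) (at_right 0)"
    by (intro tendsto_intros filterlim_compose[OF tendsto_arctan_at_bot])
  then show ?thesis using True unfolding angle_def by simp
next
  case False
  then have "filterlim (\<lambda>e. (x - t) / e) at_top (at_right (0::real))"
    using assms unfolding divide_inverse
    by (intro filterlim_tendsto_pos_mult_at_top[OF tendsto_const] filterlim_inverse_at_top_right) auto
  then have "((\<lambda>e. pi / 2 + arctan ((x - t) / e)) \<longlongrightarrow> pi / 2 + pi / 2) (at_right 0)"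
    by (intro tendsto_intros filterlim_compose[OF tendsto_arctan_at_top])
  then show ?thesis using False unfolding angle_def by simp
qed

lemma angle_sum_tendsto:
  assumes "t \<notin> set xs"
  shows "((\<lambda>e. \<Sum>x\<leftarrow>xs. angle (Complex t e) x) \<longlongrightarrow>
    pi * (real (length xs) - real (length (filter (\<lambda>x. x \<le> t) xs)))) (at_right 0)"
  using assms
proof (induction xs)
  case (Cons x xs)
  have "((\<lambda>e. angle (Complex t e) x + (\<Sum>x\<leftarrow>xs. angle (Complex t e) x)) \<longlongrightarrow>
    (if x \<le> t then 0 else pi) + pi * (real (length xs) - real (length (filter (\<lambda>x. x \<le> t) xs)))) (at_right 0)"
    using Cons by (intro tendsto_add angle_tendsto) auto
  moreover have "(if x \<le> t then 0 else pi) + pi * (real (length xs) - real (length (filter (\<lambda>x. x \<le> t) xs)))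
      = pi * (real (length (x # xs)) - real (length (filter (\<lambda>x. x \<le> t) (x # xs))))"
    by (simp add: algebra_simps)
  ultimately show ?case by simp
qed simp

lemma continuous_on_angle_sum:
  "continuous_on {z. Im z > 0} (\<lambda>z. \<Sum>x\<leftarrow>xs. angle z x)"
  by (induction xs) (auto simp: angle_def intro!: continuous_intros)

text \<open>The angle difference of \<open>P\<close> and \<open>Q\<close> avoids the multiples of \<open>pi\<close> on the connected upper
  half-plane; its boundary values at real points count zeros.\<close>

lemma zeros_interlace_if_nonreal_quotient:
  assumes "hyperbolic P" "hyperbolic Q"
    and nonreal: "\<And>z. Im z > 0 \<Longrightarrow> Im (ev P z * cnj (ev Q z)) \<noteq> 0"
  shows "zeros_interlace P Q"
proof -
  have PQ: "P \<noteq> 0" "Q \<noteq> 0" using assms(1,2) by (auto simp: hyperbolic_def)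
  obtain xs ys where xs: "is_zero_list P xs" and ys: "is_zero_list Q ys"
    using hyperbolic_factor[OF assms(1)] hyperbolic_factor[OF assms(2)] by blast
  let ?H = "{z. Im z > 0}"
  define \<Theta> where "\<Theta> z = (\<Sum>x\<leftarrow>xs. angle z x) - (\<Sum>y\<leftarrow>ys. angle z y)" for z
  have sin: "sin (\<Theta> z) \<noteq> 0" if "Im z > 0" for z
    using Im_ev_quotient[OF xs ys that PQ] nonreal[OF that] unfolding \<Theta>_def by blast
  have "continuous_on ?H \<Theta>" unfolding \<Theta>_def[abs_def]
    by (rule continuous_on_diff[OF continuous_on_angle_sum continuous_on_angle_sum])
  then have "connected (\<Theta> ` ?H)"
    by (rule connected_continuous_image) (rule convex_connected[OF convex_halfspace_Im_gt])
  then have ivl: "is_interval (\<Theta> ` ?H)" by (simp add: is_interval_connected_1)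
  define m where "m = \<lfloor>\<Theta> \<i> / pi\<rfloor>"
  have i: "m * pi \<le> \<Theta> \<i>" "\<Theta> \<i> < (m + 1) * pi"
    using floor_correct[of "\<Theta> \<i> / pi"] unfolding m_def[symmetric]
    by (simp_all add: pos_le_divide_eq pos_divide_less_eq)
  have notin: "of_int k * pi \<notin> \<Theta> ` ?H" for k
  proof
    assume "of_int k * pi \<in> \<Theta> ` ?H"
    then obtain z where "Im z > 0" "\<Theta> z = of_int k * pi" by auto
    then show False using sin[of z] sin_zero_iff_int2 by blast
  qed
  have bounds: "m * pi \<le> \<Theta> z \<and> \<Theta> z \<le> (m + 1) * pi" if "Im z > 0" for z
  proof (rule ccontr)
    assume *: "\<not> ?thesis"
    have in_image: "\<Theta> z \<in> \<Theta> ` ?H" "\<Theta> \<i> \<in> \<Theta> ` ?H" using that by auto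
    consider "\<Theta> z < m * pi" | "(m + 1) * pi < \<Theta> z" using * by linarith
    then show False
    proof cases
      case 1
      then have "m * pi \<in> \<Theta> ` ?H"
        using mem_is_interval_1_I[OF ivl in_image] i(1) by simp
      then show False using notin by blast
    next
      case 2
      then have "of_int (m + 1) * pi \<in> \<Theta> ` ?H"
        using mem_is_interval_1_I[OF ivl in_image(2) in_image(1)] i(2) by simp
      then show False using notin by blast
    qed
  qed
  define Nx where "Nx t = int (length (filter (\<lambda>x. x \<le> t) xs))" for t
  define Ny where "Ny t = int (length (filter (\<lambda>y. y \<le> t) ys))" for t
  define l where "l = int (length xs) - int (length ys)"
  have generic: "m \<le> l - (Nx t - Ny t) \<and> l - (Nx t - Ny t) \<le> m + 1" if t: "t \<notin> set xs \<union> set ys" for t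
  proof -
    let ?L = "pi * (real (length xs) - real (length (filter (\<lambda>x. x \<le> t) xs)))
      - pi * (real (length ys) - real (length (filter (\<lambda>y. y \<le> t) ys)))"
    have lim: "((\<lambda>e. \<Theta> (Complex t e)) \<longlongrightarrow> ?L) (at_right 0)"
      unfolding \<Theta>_def using t by (intro tendsto_diff angle_sum_tendsto) auto
    have ev: "\<forall>\<^sub>F e in at_right (0::real). m * pi \<le> \<Theta> (Complex t e) \<and> \<Theta> (Complex t e) \<le> (m + 1) * pi"
      using eventually_at_right_less[of "0::real"] by eventually_elim (use bounds in auto)
    have "m * pi \<le> ?L"
      by (rule tendsto_lowerbound[OF lim]) (use ev in \<open>auto elim: eventually_mono\<close>)
    moreover have "?L \<le> (m + 1) * pi"
      by (rule tendsto_upperbound[OF lim]) (use ev in \<open>auto elim: eventually_mono\<close>)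
    moreover have "?L = of_int (l - (Nx t - Ny t)) * pi"
      unfolding l_def Nx_def Ny_def by (simp add: algebra_simps)
    ultimately have "real_of_int m \<le> of_int (l - (Nx t - Ny t))" "of_int (l - (Nx t - Ny t)) \<le> real_of_int (m + 1)"
      by (simp_all only: mult_le_cancel_right_pos pi_gt_zero)
    then show ?thesis by linarith
  qed
  \<comment> \<open>The counts are right-continuous: a zero \<open>t\<close> is replaced by some
    \<open>s > t\<close> with no zero in between or at \<open>s\<close>.\<close>
  have all: "m \<le> l - (Nx t - Ny t) \<and> l - (Nx t - Ny t) \<le> m + 1" for t
  proof -
    have "finite {u \<in> set xs \<union> set ys. u > t}" by simp
    then obtain s where s: "s > t" "\<And>u. u \<in> set xs \<union> set ys \<Longrightarrow> u > t \<Longrightarrow> s < u"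
    proof (cases "{u \<in> set xs \<union> set ys. u > t} = {}")
      case True
      then show ?thesis by (intro that[of "t + 1"]) auto
    next
      case False
      define M where "M = Min {u \<in> set xs \<union> set ys. u > t}"
      have M: "M > t" unfolding M_def using Min_in[OF _ False] by simp
      have M': "M \<le> u" if "u \<in> set xs \<union> set ys" "u > t" for u
        unfolding M_def using that by (intro Min_le) auto
      show ?thesis
      proof (rule that)
        show "(t + M) / 2 > t" using M by simp
        show "(t + M) / 2 < u" if "u \<in> set xs \<union> set ys" "u > t" for u
          using M M'[OF that] by simp
      qed
    qed
    have "u \<le> s \<longleftrightarrow> u \<le> t" if "u \<in> set xs \<union> set ys" for u
      using s(1) s(2)[OF that] by linarith
    then have "Nx s = Nx t" "Ny s = Ny t"
      unfolding Nx_def Ny_def by (auto intro!: arg_cong[where f = length] filter_cong)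
    moreover have "s \<notin> set xs \<union> set ys" using s by blast
    ultimately show ?thesis using generic[of s] by simp
  qed
  define t0 where "t0 = Max (insert 0 (set xs \<union> set ys))"
  have "u \<le> t0" if "u \<in> set xs \<union> set ys" for u
    unfolding t0_def using that by (intro Max_ge) auto
  then have "filter (\<lambda>x. x \<le> t0) xs = xs" "filter (\<lambda>x. x \<le> t0) ys = ys"
    by (auto simp: filter_id_conv)
  then have top: "m \<le> 0" "0 \<le> m + 1" using all[of t0] unfolding Nx_def Ny_def l_def by auto
  \<comment> \<open>Left of all zeros both counts vanish, so \<open>l\<close> is \<open>m\<close> or
    \<open>m + 1\<close>. This decides whether \<open>Nx - Ny\<close> ranges over -1 and 0 or over 0
    and 1, that is, which list comes first.\<close>
  define t1 where "t1 = Min (insert 0 (set xs \<union> set ys))"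
  have "t1 \<le> u" if "u \<in> set xs \<union> set ys" for u
    unfolding t1_def using that by (intro Min_le) auto
  then have "\<not> u \<le> t1 - 1" if "u \<in> set xs \<union> set ys" for u
    using that by fastforce
  then have "filter (\<lambda>x. x \<le> t1 - 1) xs = []" "filter (\<lambda>x. x \<le> t1 - 1) ys = []"
    by (auto simp: filter_empty_conv)
  then have bot: "m \<le> l" "l \<le> m + 1" using all[of "t1 - 1"] unfolding Nx_def Ny_def by auto
  have "(\<forall>t. Ny t \<le> Nx t \<and> Nx t \<le> Ny t + 1) \<or> (\<forall>t. Nx t \<le> Ny t \<and> Ny t \<le> Nx t + 1)"
  proof -
    have "m = 0 \<or> m = -1" using top by linarith
    moreover have "l = m \<or> l = m + 1" using bot by linarith
    ultimately consider "l = m" | "l = m + 1" by blast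
    then show ?thesis
    proof cases
      case 1
      then have "Nx t \<le> Ny t \<and> Ny t \<le> Nx t + 1" for t using all[of t] by linarith
      then show ?thesis by blast
    next
      case 2
      then have "Ny t \<le> Nx t \<and> Nx t \<le> Ny t + 1" for t using all[of t] by linarith
      then show ?thesis by blast
    qed
  qed
  moreover have sorted: "sorted xs" "sorted ys" using xs ys unfolding is_zero_list_def by auto
  moreover have "interlace_from xs ys" if *: "\<forall>t. Ny t \<le> Nx t \<and> Nx t \<le> Ny t + 1"
  proof (rule interlace_from_if_counts[OF sorted])
    fix t
    show "length (filter (\<lambda>y. y \<le> t) ys) \<le> length (filter (\<lambda>x. x \<le> t) xs)"
      "length (filter (\<lambda>x. x \<le> t) xs) \<le> length (filter (\<lambda>y. y \<le> t) ys) + 1"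
      using *[rule_format, of t] unfolding Nx_def Ny_def by linarith+
  qed
  moreover have "interlace_from ys xs" if *: "\<forall>t. Nx t \<le> Ny t \<and> Ny t \<le> Nx t + 1"
  proof (rule interlace_from_if_counts[OF sorted(2) sorted(1)])
    fix t
    show "length (filter (\<lambda>x. x \<le> t) xs) \<le> length (filter (\<lambda>y. y \<le> t) ys)"
      "length (filter (\<lambda>y. y \<le> t) ys) \<le> length (filter (\<lambda>x. x \<le> t) xs) + 1"
      using *[rule_format, of t] unfolding Nx_def Ny_def by linarith+
  qed
  ultimately have "interlace_from xs ys \<or> interlace_from ys xs" by blast
  then show ?thesis unfolding zeros_interlace_def using xs ys by blast
qed

text \<open>This lets a range of dimension at most one be written as a pencil with
  \<open>P = Q\<close>.\<close>

lemma zeros_interlace_refl: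
  assumes "hyperbolic P"
  shows "zeros_interlace P P"
proof -
  obtain xs where xs: "is_zero_list P xs" using hyperbolic_factor[OF assms] by blast
  then have "interlace_from xs xs" unfolding is_zero_list_def by (intro interlace_from_if_counts) auto
  then show ?thesis unfolding zeros_interlace_def using xs by blast
qed

section \<open>Stable symbols from preservers\<close>

text \<open>Each linear factor has its zero strictly below the real axis and so loses modulus when
  \<open>z\<close> is reflected. The induction carries the weak inequality along to start from
  constants.\<close>

lemma cmod_poly_cnj_less:
  fixes h :: "complex poly"
  assumes "\<And>z. Im z \<ge> 0 \<Longrightarrow> poly h z \<noteq> 0" "degree h > 0" and z: "Im z > 0"
  shows "cmod (poly h (cnj z)) < cmod (poly h z)"
proof -
  have "h \<noteq> 0" using assms(2) by auto
  then have "(\<forall>z. Im z \<ge> 0 \<longrightarrow> poly h z \<noteq> 0) \<longrightarrow> cmod (poly h (cnj z)) \<le> cmod (poly h z) \<and>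
      (degree h > 0 \<longrightarrow> cmod (poly h (cnj z)) < cmod (poly h z))"
  proof (induction h rule: poly_linear_factor_induct)
    case (linear r q)
    show ?case
    proof (intro impI)
      assume *: "\<forall>z. Im z \<ge> 0 \<longrightarrow> poly ([:- r, 1:] * q) z \<noteq> 0"
      have "poly ([:- r, 1:] * q) r = 0" by simp
      then have r: "Im r < 0" using * by (meson not_less)
      have q: "poly q u \<noteq> 0" if "Im u \<ge> 0" for u using * that by (metis poly_mult mult_zero_right)
      have "cmod (poly q (cnj z)) \<le> cmod (poly q z)" using linear.IH q by blast
      then have "cmod (cnj z - r) * cmod (poly q (cnj z)) \<le> cmod (cnj z - r) * cmod (poly q z)"
        by (rule mult_left_mono) simp
      also have "\<dots> < cmod (z - r) * cmod (poly q z)"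
        using q[of z] z by (intro mult_strict_right_mono cmod_cnj_diff_less r) auto
      finally have "cmod (poly ([:- r, 1:] * q) (cnj z)) < cmod (poly ([:- r, 1:] * q) z)"
        by (simp add: norm_mult[symmetric] algebra_simps)
      then show "cmod (poly ([:- r, 1:] * q) (cnj z)) \<le> cmod (poly ([:- r, 1:] * q) z) \<and>
        (degree ([:- r, 1:] * q) > 0 \<longrightarrow> cmod (poly ([:- r, 1:] * q) (cnj z)) < cmod (poly ([:- r, 1:] * q) z))"
        by (meson less_imp_le)
    qed
  qed simp
  then show ?thesis using assms by blast
qed

lemma ev_map_poly_Re: "2 * ev (map_poly Re h) z = poly h z + cnj (poly h (cnj z))"
proof -
  have "smult 2 (map_poly of_real (map_poly Re h)) = h + map_poly cnj h"
    by (intro poly_eqI) (simp add: coeff_map_poly complex_eq_iff)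
  then have "poly (smult 2 (map_poly of_real (map_poly Re h))) z = poly (h + map_poly cnj h) z"
    by (rule arg_cong)
  then show ?thesis by simp
qed

lemma hyperbolic_map_poly_Re:
  assumes "\<And>z. Im z \<ge> 0 \<Longrightarrow> poly h z \<noteq> 0" "degree h > 0"
  shows "hyperbolic (map_poly Re h)"
  unfolding hyperbolic_iff
proof (intro allI impI notI)
  fix z assume z: "Im z > 0" and "ev (map_poly Re h) z = 0"
  then have "poly h z = - cnj (poly h (cnj z))"
    using ev_map_poly_Re[of h z] by (simp add: eq_neg_iff_add_eq_0)
  then have "cmod (poly h z) = cmod (poly h (cnj z))" by (metis complex_mod_cnj norm_minus_cancel)
  then show False using cmod_poly_cnj_less[OF assms z] by simp
qed

text \<open>Expand \<open>f\<close> in powers of \<open>z + w\<close>. On the closed upper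
  half-plane \<open>cmod (z + w)\<close> is at least \<open>Im w\<close>, so every power up to the
  \<open>n\<close>-th is bounded by a constant times the \<open>n\<close>-th. A small multiple of
  \<open>f\<close> therefore cannot cancel \<open>c (z + w)^n\<close> there, and
  \<open>hyperbolic_map_poly_Re\<close> applies to the sum.\<close>

lemma hyperbolic_perturbation:
  fixes f :: "real poly"
  assumes f: "degree f \<le> n" and n: "n > 0" and c: "c \<noteq> 0" and w: "Im w > 0"
  shows "\<exists>\<epsilon>>0. hyperbolic (map_poly Re (smult c ([:w, 1:] ^ n)) + smult \<epsilon> f)"
proof -
  define g where "g = map_poly complex_of_real f"
  define G where "G = pcompose g [:- w, 1:]"
  define M where "M = (\<Sum>j\<le>n. cmod (coeff G j) / Im w ^ (n - j))"
  have degG: "degree G \<le> n"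
    using f unfolding G_def g_def by (simp add: degree_pcompose degree_map_poly)
  have M0: "M \<ge> 0" unfolding M_def using w by (intro sum_nonneg) auto
  have bound: "cmod (poly g z) \<le> M * cmod (z + w) ^ n" if z: "Im z \<ge> 0" for z
  proof -
    have v: "cmod (z + w) \<ge> Im w"
      using abs_Im_le_cmod[of "z + w"] z w by simp
    have "poly g z = poly G (z + w)" unfolding G_def by (simp add: poly_pcompose)
    also have "\<dots> = (\<Sum>j\<le>n. coeff G j * (z + w) ^ j)"
      unfolding poly_altdef by (rule sum.mono_neutral_left) (use degG in \<open>auto simp: coeff_eq_0\<close>)
    also have "cmod \<dots> \<le> (\<Sum>j\<le>n. cmod (coeff G j) / Im w ^ (n - j) * cmod (z + w) ^ n)"
    proof (rule sum_norm_le)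
      fix j assume "j \<in> {..n}"
      then have "cmod (z + w) ^ n = cmod (z + w) ^ (n - j) * cmod (z + w) ^ j"
        by (simp flip: power_add)
      moreover have "Im w ^ (n - j) \<le> cmod (z + w) ^ (n - j)"
        using v w by (intro power_mono) auto
      ultimately have "Im w ^ (n - j) * cmod (z + w) ^ j \<le> cmod (z + w) ^ n"
        by (simp add: mult_right_mono)
      then have "cmod (coeff G j) * (Im w ^ (n - j) * cmod (z + w) ^ j) \<le> cmod (coeff G j) * cmod (z + w) ^ n"
        by (rule mult_left_mono) simp
      then show "cmod (coeff G j * (z + w) ^ j) \<le> cmod (coeff G j) / Im w ^ (n - j) * cmod (z + w) ^ n"
        using w by (simp add: norm_mult norm_power field_simps)
    qed
    finally show ?thesis unfolding M_def sum_distrib_right .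
  qed
  define b where "b = cmod (coeff g n)"
  \<comment> \<open>\<open>M\<close> guards against zeros in the closed half-plane, \<open>b\<close>
    against cancellation of the coefficient of degree \<open>n\<close>; the 1 makes both estimates
    strict.\<close>
  define \<epsilon> where "\<epsilon> = cmod c / (M + b + 1)"
  have pos: "M + b + 1 > 0" using M0 unfolding b_def by (simp add: add_nonneg_pos)
  then have \<epsilon>: "\<epsilon> > 0" using c unfolding \<epsilon>_def by simp
  have less: "\<epsilon> * x < cmod c" if "x < M + b + 1" for x
  proof -
    have "\<epsilon> * x < \<epsilon> * (M + b + 1)" using that \<epsilon> by simp
    also have "\<dots> = cmod c" using pos unfolding \<epsilon>_def by simp
    finally show ?thesis .
  qed
  define h where "h = smult c ([:w, 1:] ^ n) + smult (of_real \<epsilon>) g"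
  have "poly h z \<noteq> 0" if z: "Im z \<ge> 0" for z
  proof
    assume "poly h z = 0"
    then have "c * (z + w) ^ n = - (of_real \<epsilon> * poly g z)"
      unfolding h_def by (simp add: eq_neg_iff_add_eq_0 add.commute)
    then have "cmod c * cmod (z + w) ^ n = \<epsilon> * cmod (poly g z)"
      using \<epsilon> by (metis abs_of_pos norm_minus_cancel norm_mult norm_of_real norm_power)
    also have "\<dots> \<le> \<epsilon> * (M * cmod (z + w) ^ n)"
      using bound[OF z] \<epsilon> by (intro mult_left_mono) auto
    finally have "cmod c * cmod (z + w) ^ n \<le> \<epsilon> * M * cmod (z + w) ^ n"
      by (simp only: mult.assoc)
    moreover have "cmod (z + w) ^ n > 0" using z w by (auto simp: complex_eq_iff)
    ultimately have "cmod c \<le> \<epsilon> * M" by (simp only: mult_le_cancel_right_pos)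
    then show False using less[of M] norm_ge_zero[of "coeff g n"] unfolding b_def by linarith
  qed
  moreover have "degree h > 0"
  proof -
    have "coeff h n = c + of_real \<epsilon> * coeff g n"
      unfolding h_def by (simp add: coeff_linear_power)
    moreover have "cmod (of_real \<epsilon> * coeff g n) < cmod c"
      using less[of b] M0 \<epsilon> unfolding b_def by (simp add: norm_mult)
    ultimately have "coeff h n \<noteq> 0"
      by (metis add_eq_0_iff less_irrefl norm_minus_cancel)
    then show ?thesis using n le_degree by fastforce
  qed
  ultimately have "hyperbolic (map_poly Re h)" by (rule hyperbolic_map_poly_Re)
  also have "map_poly Re h = map_poly Re (smult c ([:w, 1:] ^ n)) + smult \<epsilon> f"
    unfolding h_def g_def by (intro poly_eqI) (simp add: coeff_map_poly)
  finally show ?thesis using \<epsilon> by blast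
qed

section \<open>The symbol as a function of two complex variables\<close>

lemma linear_op_Rn_expand:
  assumes T: "linear_op_Rn n T" and f: "f \<in> Rn n"
  shows "T f = (\<Sum>k\<le>n. smult (coeff f k) (T (monom 1 k)))"
proof -
  have "T (\<Sum>k\<le>m. monom (coeff f k) k) = (\<Sum>k\<le>m. smult (coeff f k) (T (monom 1 k)))" if "m \<le> n" for m
    using that
  proof (induction m)
    case 0
    have "monom 1 0 \<in> Rn n" unfolding Rn_def by simp
    then have "T (smult (coeff f 0) (monom 1 0)) = smult (coeff f 0) (T (monom 1 0))"
      using T unfolding linear_op_Rn_def by blast
    then show ?case unfolding smult_monom mult_1_right by simp
  next
    case (Suc m)
    have "degree (\<Sum>k\<le>m. monom (coeff f k) k) \<le> n"
      using Suc.prems by (intro degree_sum_le) (auto intro: order.trans[OF degree_monom_le])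
    moreover have "degree (monom (coeff f (Suc m)) (Suc m)) \<le> n"
      using Suc.prems by (auto intro: order.trans[OF degree_monom_le])
    ultimately have "T (\<Sum>k\<le>Suc m. monom (coeff f k) k)
        = T (\<Sum>k\<le>m. monom (coeff f k) k) + T (monom (coeff f (Suc m)) (Suc m))"
      using T unfolding linear_op_Rn_def Rn_def by simp
    also have "T (monom (coeff f (Suc m)) (Suc m)) = T (smult (coeff f (Suc m)) (monom 1 (Suc m)))"
      by (simp add: smult_monom)
    also have "\<dots> = smult (coeff f (Suc m)) (T (monom 1 (Suc m)))"
      using T Suc.prems unfolding linear_op_Rn_def Rn_def by (simp add: degree_monom_eq)
    finally show ?case using Suc by simp
  qed
  from this[of n] show ?thesis
    using f poly_as_sum_of_monoms'[of f n] unfolding Rn_def by simp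
qed

text \<open>The value of \<open>T[(z + w)^n]\<close> at complex \<open>z\<close> and
  \<open>w\<close>. Moving the sign \<open>s\<close> into \<open>w\<close> makes conditions (b) and
  (c) statements about this one function.\<close>

definition symbol :: "(real poly \<Rightarrow> real poly) \<Rightarrow> nat \<Rightarrow> complex \<Rightarrow> complex \<Rightarrow> complex" where
  "symbol T n z w = (\<Sum>k\<le>n. of_nat (n choose k) * (ev (T (monom 1 k)) z * w ^ (n - k)))"

lemma eval2_T_symbol: "eval2 (T_symbol T n s) z w = symbol T n z (of_real s * w)"
proof -
  have "map_poly (\<lambda>q. ev q z) (T_symbol T n s) = (\<Sum>k\<le>n. monom (ev (smult (real (n choose k) * s ^ (n - k)) (T (monom 1 k))) z) (n - k))"
    unfolding T_symbol_def
    by (intro poly_eqI) (auto simp: coeff_map_poly coeff_sum ev_sum intro!: sum.cong)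
  then show ?thesis unfolding eval2_def symbol_def
    by (simp add: poly_sum poly_monom ev_smult power_mult_distrib mult_ac)
qed

lemma real_stable2_T_symbol:
  "real_stable2 (T_symbol T n s) \<longleftrightarrow>
    (\<forall>z w. Im z > 0 \<longrightarrow> Im w > 0 \<longrightarrow> symbol T n z (of_real s * w) \<noteq> 0)"
proof -
  have "eval2 0 \<i> \<i> = 0" unfolding eval2_def by simp
  then show ?thesis unfolding real_stable2_def eval2_T_symbol[symmetric]
    by (metis imaginary_unit.sel(2) zero_less_one)
qed

text \<open>The complex-linear extension of \<open>T\<close> commutes with conjugation of
  coefficients. Conjugating the coefficients of \<open>c (z + w)^n\<close> changes \<open>c\<close>
  and \<open>w\<close> but leaves the evaluation point \<open>z\<close> alone.\<close>

lemma ev_map_poly_Re_symbol: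
  assumes "linear_op_Rn n T"
  shows "2 * ev (T (map_poly Re (smult c ([:w, 1:] ^ n)))) z = c * symbol T n z w + cnj c * symbol T n z (cnj w)"
proof -
  let ?p = "map_poly Re (smult c ([:w, 1:] ^ n))"
  have "degree ?p \<le> n"
    using degree_linear_power[of w n] map_poly_degree_leq[of Re "smult c ([:w, 1:] ^ n)"]
      degree_smult_le[of c "[:w, 1:] ^ n"] by linarith
  then have "T ?p = (\<Sum>k\<le>n. smult (coeff ?p k) (T (monom 1 k)))"
    by (intro linear_op_Rn_expand assms) (simp add: Rn_def)
  then have "2 * ev (T ?p) z = (\<Sum>k\<le>n. 2 * of_real (coeff ?p k) * ev (T (monom 1 k)) z)"
    by (simp only: ev_sum ev_smult sum_distrib_left mult.assoc)
  also have "\<dots> = (\<Sum>k\<le>n. (c * of_nat (n choose k) * w ^ (n - k) + cnj c * of_nat (n choose k) * cnj w ^ (n - k))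
      * ev (T (monom 1 k)) z)"
  proof (intro sum.cong refl arg_cong2[where f = "(*)"])
    fix k assume "k \<in> {..n}"
    then have "coeff ([:w, 1:] ^ n) k = of_nat (n choose k) * w ^ (n - k)"
      using coeff_linear_poly_power[of k n w 1] by simp
    then have "coeff ?p k = Re (c * of_nat (n choose k) * w ^ (n - k))"
      by (simp add: coeff_map_poly mult.assoc)
    then have "2 * complex_of_real (coeff ?p k) = c * of_nat (n choose k) * w ^ (n - k) + cnj (c * of_nat (n choose k) * w ^ (n - k))"
      by (simp only: complex_add_cnj) simp
    then show "2 * complex_of_real (coeff ?p k) = c * of_nat (n choose k) * w ^ (n - k) + cnj c * of_nat (n choose k) * cnj w ^ (n - k)"
      by simp
  qed
  also have "\<dots> = c * symbol T n z w + cnj c * symbol T n z (cnj w)"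
    unfolding symbol_def by (simp add: sum_distrib_left sum.distrib algebra_simps)
  finally show ?thesis .
qed

lemma preserver_imp_stable_symbol:
  assumes T: "linear_op_Rn n T"
    and pres: "\<And>f. f \<in> Rn n \<Longrightarrow> hyperbolic f \<Longrightarrow> hyperbolic (T f) \<or> T f = 0"
    and f0: "f0 \<in> Rn n" "\<not> hyperbolic (T f0)" "T f0 \<noteq> 0"
  shows "real_stable2 (T_symbol T n 1) \<or> real_stable2 (T_symbol T n (-1))"
proof -
  have add: "T (f + g) = T f + T g" if "f \<in> Rn n" "g \<in> Rn n" for f g
    using T that unfolding linear_op_Rn_def by blast
  have smult: "T (smult a f) = smult a (T f)" if "f \<in> Rn n" for a f
    using T that unfolding linear_op_Rn_def by blast
  have "n > 0"
  proof (rule ccontr)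
    assume "\<not> n > 0"
    then obtain a where a: "f0 = [:a:]" using f0(1) unfolding Rn_def by (auto elim: degree_eq_zeroE)
    have "f0 \<noteq> 0" using f0 smult[OF f0(1), of 0] by auto
    then have "hyperbolic f0" unfolding hyperbolic_iff a by (simp add: map_poly_pCons)
    then show False using pres f0 by blast
  qed
  \<comment> \<open>If \<open>T p = 0\<close> for the real part \<open>p\<close> of \<open>c (z + w)\<^sup>n\<close>, then \<open>p + \<epsilon> f0\<close> is hyperbolic
    for small \<open>\<epsilon>\<close> and is mapped to \<open>\<epsilon> T f0\<close>.\<close>
  have nonzero: "c * symbol T n z w + cnj c * symbol T n z (cnj w) \<noteq> 0"
    if c: "c \<noteq> 0" and w: "Im w > 0" and z: "Im z > 0" for c z w
  proof -
    define p where "p = map_poly Re (smult c ([:w, 1:] ^ n))"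
    have "degree p \<le> n" unfolding p_def
      using degree_linear_power[of w n] map_poly_degree_leq[of Re "smult c ([:w, 1:] ^ n)"]
        degree_smult_le[of c "[:w, 1:] ^ n"] by linarith
    then have p: "p \<in> Rn n" unfolding Rn_def by simp
    obtain \<epsilon> where \<epsilon>: "\<epsilon> > 0" "hyperbolic (p + smult \<epsilon> f0)"
      using hyperbolic_perturbation[of f0 n c w] f0(1) \<open>n > 0\<close> c w unfolding Rn_def p_def by auto
    have f0': "smult \<epsilon> f0 \<in> Rn n" using f0(1) unfolding Rn_def by simp
    have "hyperbolic p"
      using hyperbolic_perturbation[of 0 n c w] \<open>n > 0\<close> c w unfolding p_def by auto
    then have "hyperbolic (T p) \<or> T p = 0" using pres p by blast
    moreover have "T p \<noteq> 0"
    proof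
      assume "T p = 0"
      then have "T (p + smult \<epsilon> f0) = smult \<epsilon> (T f0)"
        using add[OF p f0'] smult[OF f0(1)] by simp
      moreover have "p + smult \<epsilon> f0 \<in> Rn n"
        using p f0' unfolding Rn_def by (auto intro: degree_add_le)
      ultimately have "hyperbolic (smult \<epsilon> (T f0)) \<or> smult \<epsilon> (T f0) = 0"
        using pres[of "p + smult \<epsilon> f0"] \<epsilon>(2) by simp
      then show False using f0 \<epsilon>(1) unfolding hyperbolic_iff ev_smult by auto
    qed
    ultimately have "ev (T p) z \<noteq> 0" using z unfolding hyperbolic_iff by blast
    then show ?thesis using ev_map_poly_Re_symbol[OF T, of c w z] unfolding p_def by auto
  qed
  define D where "D = (\<lambda>(z, w). cmod (symbol T n z w) - cmod (symbol T n z (cnj w)))"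
  have D0: "D (z, w) \<noteq> 0" if z: "Im z > 0" and w: "Im w > 0" for z w
  proof
    assume "D (z, w) = 0"
    then have eq: "cmod (symbol T n z w) = cmod (symbol T n z (cnj w))" unfolding D_def by simp
    define A where "A = symbol T n z w"
    define B where "B = symbol T n z (cnj w)"
    have eq: "cmod A = cmod B" using eq unfolding A_def B_def .
    show False
    proof (cases "A = 0")
      case True
      then show False using nonzero[of 1 w z] z w eq unfolding A_def B_def by simp
    next
      case False
      \<comment> \<open>The phase that produces cancellation: \<open>c\<close> has modulus 1 and
        \<open>c^2 A = - B\<close>, so \<open>c A = - cnj c B\<close>.\<close>
      define c where "c = csqrt (- B / A)"
      have "cmod (- B / A) = 1" using False eq by (auto simp: norm_divide)
      then have "cmod c = 1" unfolding c_def by simp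
      then have c1: "c * cnj c = 1" "c \<noteq> 0" by (auto simp: complex_norm_square[symmetric])
      have c2: "c * c = - B / A" unfolding c_def by (metis power2_csqrt power2_eq_square)
      have "c * (c * A + cnj c * B) = (c * c) * A + (c * cnj c) * B" by (simp only: algebra_simps)
      also have "\<dots> = 0" unfolding c1 c2 using False by simp
      finally show False using nonzero[OF c1(2) w z] c1(2) unfolding A_def B_def by simp
    qed
  qed
  let ?H = "{z. Im z > 0}"
  have cont: "continuous_on (?H \<times> ?H) D"
    unfolding D_def symbol_def case_prod_beta by (intro continuous_intros)
  have "connected (D ` (?H \<times> ?H))"
    by (intro connected_continuous_image[OF cont] connected_Times convex_connected convex_halfspace_Im_gt)
  then have ivl: "is_interval (D ` (?H \<times> ?H))" by (simp add: is_interval_connected_1)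
  have "0 \<notin> D ` (?H \<times> ?H)" using D0 by fastforce
  then have "(\<forall>x \<in> D ` (?H \<times> ?H). x > 0) \<or> (\<forall>x \<in> D ` (?H \<times> ?H). x < 0)"
    using mem_is_interval_1_I[OF ivl, of _ _ 0] by (metis linorder_less_linear less_imp_le)
  then have "(\<forall>z w. Im z > 0 \<longrightarrow> Im w > 0 \<longrightarrow> D (z, w) > 0) \<or> (\<forall>z w. Im z > 0 \<longrightarrow> Im w > 0 \<longrightarrow> D (z, w) < 0)"
    by (force simp: image_iff)
  then show ?thesis
  proof
    assume *: "\<forall>z w. Im z > 0 \<longrightarrow> Im w > 0 \<longrightarrow> D (z, w) > 0"
    have "symbol T n z w \<noteq> 0" if "Im z > 0" "Im w > 0" for z w
      using *[rule_format, OF that] unfolding D_def by auto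
    then show ?thesis unfolding real_stable2_T_symbol by simp
  next
    assume *: "\<forall>z w. Im z > 0 \<longrightarrow> Im w > 0 \<longrightarrow> D (z, w) < 0"
    \<comment> \<open>The point \<open>- cnj w\<close> is again in the upper half-plane and its
      conjugate is \<open>- w\<close>; a negative \<open>D\<close> makes the subtracted modulus
      positive.\<close>
    have "symbol T n z (- w) \<noteq> 0" if "Im z > 0" "Im w > 0" for z w
      using *[rule_format, of z "- cnj w"] that unfolding D_def by auto
    then show ?thesis unfolding real_stable2_T_symbol by simp
  qed
qed

section \<open>Operators with only hyperbolic or zero values\<close>

lemma linear_on_Rn_ev:
  assumes "linear_op_Rn n T" "\<And>x y. L (x + y) = L x + L y" "\<And>c x. L (of_real c * x) = c * (L x :: real)"
  shows "linear_on_Rn n (\<lambda>f. L (ev (T f) z))"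
  using assms(1) unfolding linear_on_Rn_def linear_op_Rn_def
  by (simp add: ev_add ev_smult assms(2,3) del: of_real_mult)

lemma hyperbolic_range_imp_pencil:
  assumes T: "linear_op_Rn n T"
    and hyp: "\<And>f. f \<in> Rn n \<Longrightarrow> hyperbolic (T f) \<or> T f = 0"
  shows "\<exists>(\<alpha>::real poly \<Rightarrow> real) (\<beta>::real poly \<Rightarrow> real) P Q.
        linear_on_Rn n \<alpha> \<and> linear_on_Rn n \<beta> \<and> hyperbolic P \<and> hyperbolic Q \<and>
        zeros_interlace P Q \<and> (\<forall>f\<in>Rn n. T f = smult (\<alpha> f) P + smult (\<beta> f) Q)"
proof -
  have add: "T (f + g) = T f + T g" if "f \<in> Rn n" "g \<in> Rn n" for f g
    using T that unfolding linear_op_Rn_def by blast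
  have smult: "T (smult a f) = smult a (T f)" if "f \<in> Rn n" for a f
    using T that unfolding linear_op_Rn_def by blast
  have comb_in: "f + smult a g \<in> Rn n" if "f \<in> Rn n" "g \<in> Rn n" for f g a
    using that unfolding Rn_def by (auto intro!: degree_add_le order.trans[OF degree_smult_le])
  have comb: "T (f + smult a g) = T f + smult a (T g)" if "f \<in> Rn n" "g \<in> Rn n" for f g a
  proof -
    have "smult a g \<in> Rn n" using that(2) unfolding Rn_def by (auto intro!: order.trans[OF degree_smult_le])
    then show ?thesis using add[OF that(1)] smult[OF that(2)] by simp
  qed
  \<comment> \<open>A nonzero element of the range has no zero in the upper half-plane, so \<open>e\<close> is injective on
    the range, which therefore has dimension at most two.\<close>
  define e where "e f = ev (T f) \<i>" for f
  have zero: "T f = 0" if "f \<in> Rn n" "Im z > 0" "ev (T f) z = 0" for f z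
    using hyp[OF that(1)] that unfolding hyperbolic_iff by blast
  have e_zero: "T f = 0" if "f \<in> Rn n" "e f = 0" for f
    using zero[of f \<i>] that unfolding e_def by simp
  show ?thesis
  proof (cases "\<exists>f g. f \<in> Rn n \<and> g \<in> Rn n \<and> Im (e f * cnj (e g)) \<noteq> 0")
    case True
    then obtain f g where fg: "f \<in> Rn n" "g \<in> Rn n" and D: "Im (e f * cnj (e g)) \<noteq> 0" by blast
    \<comment> \<open>Cramer's rule: \<open>e f\<close> and \<open>e g\<close> form a real basis of
      the complex plane with determinant \<open>D\<close> up to sign, and \<open>\<alpha> u\<close>,
      \<open>\<beta> u\<close> are the coordinates of \<open>e u\<close>.\<close>
    define D where "D = Im (e f * cnj (e g))"
    define \<alpha> where "\<alpha> u = Im (e u * cnj (e g)) / D" for u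
    define \<beta> where "\<beta> u = Im (e f * cnj (e u)) / D" for u
    have "linear_on_Rn n \<alpha>" unfolding \<alpha>_def[abs_def] e_def[of "_ :: real poly"]
      by (rule linear_on_Rn_ev[OF T]) (simp_all add: algebra_simps add_divide_distrib diff_divide_distrib)
    moreover have "linear_on_Rn n \<beta>" unfolding \<beta>_def[abs_def] e_def[of "_ :: real poly"]
      by (rule linear_on_Rn_ev[OF T]) (simp_all add: algebra_simps add_divide_distrib diff_divide_distrib)
    moreover have "e f \<noteq> 0" "e g \<noteq> 0" using D by auto
    then have "T f \<noteq> 0" "T g \<noteq> 0" unfolding e_def by auto
    then have hfg: "hyperbolic (T f)" "hyperbolic (T g)" using hyp fg by blast+
    moreover have "zeros_interlace (T f) (T g)"
    proof (rule zeros_interlace_if_nonreal_quotient[OF hfg], rule notI)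
      fix z assume z: "Im z > 0" and 0: "Im (ev (T f) z * cnj (ev (T g) z)) = 0"
      have gz: "ev (T g) z \<noteq> 0" using hfg z unfolding hyperbolic_iff by blast
      \<comment> \<open>If the quotient took the real value \<open>c\<close> at \<open>z\<close>,
        then \<open>T (f - c g)\<close> would vanish at \<open>z\<close>, hence be 0, and
        \<open>e f\<close> would be a real multiple of \<open>e g\<close>.\<close>
      define c where "c = Re (ev (T f) z / ev (T g) z)"
      have "ev (T f) z / ev (T g) z = of_real c"
        using 0 unfolding c_def by (simp add: complex_eq_iff Im_complex_div_eq_0)
      then have "ev (T (f + smult (- c) g)) z = 0"
        using gz unfolding comb[OF fg] ev_add ev_smult by (simp add: field_simps)
      then have "T (f + smult (- c) g) = 0" using zero[OF comb_in[OF fg] z] by blast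
      then have "ev (T f + smult (- c) (T g)) \<i> = 0" unfolding comb[OF fg] by simp
      then have "e f = of_real c * e g" unfolding ev_add ev_smult e_def by simp
      then show False using D by simp
    qed
    moreover have "T u = smult (\<alpha> u) (T f) + smult (\<beta> u) (T g)" if u: "u \<in> Rn n" for u
    proof -
      have D0: "D \<noteq> 0" using D unfolding D_def .
      then have D_times: "D * \<alpha> u = Im (e u * cnj (e g))" "D * \<beta> u = Im (e f * cnj (e u))"
        unfolding \<alpha>_def \<beta>_def by simp_all
      have "of_real D * e u = of_real (Im (e u * cnj (e g))) * e f + of_real (Im (e f * cnj (e u))) * e g"
        unfolding D_def by (simp add: complex_eq_iff algebra_simps)
      also have "\<dots> = of_real D * (of_real (\<alpha> u) * e f + of_real (\<beta> u) * e g)"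
        unfolding distrib_left mult.assoc[symmetric] of_real_mult[symmetric] D_times ..
      finally have eu: "e u = of_real (\<alpha> u) * e f + of_real (\<beta> u) * e g"
        using D0 by (simp only: mult_cancel_left of_real_eq_0_iff simp_thms)
      define v where "v = u + smult (- \<alpha> u) f + smult (- \<beta> u) g"
      have v: "v \<in> Rn n" unfolding v_def by (intro comb_in u fg)
      have Tv: "T v = T u + smult (- \<alpha> u) (T f) + smult (- \<beta> u) (T g)"
        unfolding v_def comb[OF comb_in[OF u fg(1)] fg(2)] comb[OF u fg(1)] ..
      have "e v = e u - of_real (\<alpha> u) * e f - of_real (\<beta> u) * e g"
        unfolding e_def Tv ev_add ev_smult by simp
      then have "T v = 0" using e_zero[OF v] eu by simp
      then show ?thesis unfolding Tv by (simp add: algebra_simps)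
    qed
    ultimately show ?thesis
      by (intro exI[of _ \<alpha>] exI[of _ \<beta>] exI[of _ "T f"] exI[of _ "T g"] conjI ballI)
  next
    case False
    \<comment> \<open>Now all values of \<open>e\<close> lie on one real line through 0, so the
      range has dimension at most one.\<close>
    show ?thesis
    proof (cases "\<exists>f\<in>Rn n. T f \<noteq> 0")
      case True
      then obtain f where f: "f \<in> Rn n" "T f \<noteq> 0" by blast
      then have hf: "hyperbolic (T f)" using hyp by blast
      have ef: "e f \<noteq> 0" using e_zero f by blast
      define \<alpha> where "\<alpha> u = Re (e u / e f)" for u
      have "linear_on_Rn n \<alpha>" unfolding \<alpha>_def[abs_def] e_def[of "_ :: real poly"]
        by (rule linear_on_Rn_ev[OF T]) (simp_all add: add_divide_distrib flip: times_divide_eq_right)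
      moreover have "linear_on_Rn n (\<lambda>_. 0 :: real)" unfolding linear_on_Rn_def by simp
      moreover have "T u = smult (\<alpha> u) (T f) + smult 0 (T f)" if u: "u \<in> Rn n" for u
      proof -
        have "Im (e u * cnj (e f)) = 0" using False u f by blast
        then have "e u / e f = of_real (\<alpha> u)"
          unfolding \<alpha>_def by (simp add: complex_eq_iff Im_complex_div_eq_0)
        then have "e u = of_real (\<alpha> u) * e f" using ef by (simp add: field_simps)
        then have "e (u + smult (- \<alpha> u) f) = 0"
          unfolding e_def comb[OF u f(1)] ev_add ev_smult by simp
        then have "T (u + smult (- \<alpha> u) f) = 0" using e_zero comb_in u f by blast
        then show ?thesis unfolding comb[OF u f(1)] by (simp add: algebra_simps)
      qed
      ultimately show ?thesis using hf zeros_interlace_refl[OF hf]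
        by (intro exI[of _ \<alpha>] exI[of _ "\<lambda>_. 0"] exI[of _ "T f"] conjI ballI)
    next
      case False
      have "hyperbolic 1" unfolding hyperbolic_iff by simp
      moreover have "linear_on_Rn n (\<lambda>_. 0 :: real)" unfolding linear_on_Rn_def by simp
      moreover have "\<forall>f\<in>Rn n. T f = smult 0 1 + smult 0 1" using False by simp
      ultimately show ?thesis using zeros_interlace_refl[of 1]
        by (intro exI[of _ "\<lambda>_. 0"] exI[of _ 1] conjI) simp_all
    qed
  qed
qed

section \<open>Reduction of the minus sign to the plus sign\<close>

lemma hyperbolic_reflect:
  assumes "hyperbolic f"
  shows "hyperbolic (pcompose f [:0, -1:])"
proof -
  have ev: "ev (pcompose f [:0, -1:]) z = ev f (- z)" for z
  proof (induction f)
    case (pCons a f)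
    have "ev (pcompose (pCons a f) [:0, -1:]) z = ev [:a:] z + ev [:0, -1:] z * ev (pcompose f [:0, -1:]) z"
      unfolding pcompose_pCons ev_add ev_mult ..
    then show ?case unfolding pCons.IH by (simp add: map_poly_pCons)
  qed simp
  show ?thesis using assms unfolding hyperbolic_iff ev
  proof (intro allI impI)
    fix z assume *: "\<forall>z. 0 < Im z \<longrightarrow> ev f z \<noteq> 0" and "0 < Im z"
    then have "ev f (- cnj z) \<noteq> 0" by simp
    then show "ev f (- z) \<noteq> 0" using ev_cnj[of f "- z"] by auto
  qed
qed

text \<open>Replace \<open>f(z)\<close> by \<open>f(s z)\<close> and \<open>T(z^k)\<close> by
  \<open>s^k T(z^k)\<close>. As \<open>s^2 = 1\<close>, the two changes cancel in
  \<open>T f\<close>, while the symbol with sign \<open>s\<close> becomes, up to the factor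
  \<open>s^n\<close>, one with sign plus.\<close>

lemma real_stable2_imp_preserver:
  assumes T: "linear_op_Rn n T" and stable: "real_stable2 (T_symbol T n s)" and s: "s = 1 \<or> s = -1"
    and f: "f \<in> Rn n" "hyperbolic f"
  shows "hyperbolic (T f) \<or> T f = 0"
proof -
  define \<tau> where "\<tau> k = smult (s ^ k) (T (monom 1 k))" for k
  define g where "g = pcompose f [:0, s:]"
  have ss: "s ^ k * s ^ k = 1" for k using s by (auto simp flip: power_mult_distrib)
  have g: "hyperbolic g" using s hyperbolic_reflect[OF f(2)] f(2) unfolding g_def by auto
  have "degree g \<le> n" using f s unfolding g_def Rn_def by (auto simp: degree_pcompose)
  moreover have "(\<Sum>k\<le>n. of_nat (n choose k) * (ev (\<tau> k) z * w ^ (n - k))) \<noteq> 0"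
    if "Im z > 0" "Im w > 0" for z w
  proof -
    have "symbol T n z (of_real s * w) \<noteq> 0" using stable that unfolding real_stable2_T_symbol by blast
    moreover have "of_real (s ^ n) * symbol T n z (of_real s * w)
      = (\<Sum>k\<le>n. of_nat (n choose k) * (ev (\<tau> k) z * w ^ (n - k)))"
      unfolding symbol_def sum_distrib_left
    proof (intro sum.cong refl)
      fix k assume "k \<in> {..n}"
      then have "s ^ n = s ^ k * s ^ (n - k)" by (simp flip: power_add)
      then have "s ^ n * s ^ (n - k) = s ^ k * (s ^ (n - k) * s ^ (n - k))"
        by (simp only: mult.assoc)
      then have "s ^ n * s ^ (n - k) = s ^ k" unfolding ss by simp
      then have eq: "complex_of_real (s ^ n) * of_real s ^ (n - k) = of_real (s ^ k)"
        by (simp only: of_real_mult[symmetric] of_real_power[symmetric])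
      have "complex_of_real (s ^ n) * (of_nat (n choose k) * (ev (T (monom 1 k)) z * (of_real s * w) ^ (n - k)))
        = of_nat (n choose k) * (((complex_of_real (s ^ n) * of_real s ^ (n - k)) * ev (T (monom 1 k)) z) * w ^ (n - k))"
        unfolding power_mult_distrib by (simp only: mult_ac)
      then show "complex_of_real (s ^ n) * (of_nat (n choose k) * (ev (T (monom 1 k)) z * (of_real s * w) ^ (n - k)))
        = of_nat (n choose k) * (ev (\<tau> k) z * w ^ (n - k))"
        unfolding \<tau>_def ev_smult eq .
    qed
    moreover have "complex_of_real (s ^ n) \<noteq> 0" using s by auto
    ultimately show ?thesis by (metis mult_eq_0_iff)
  qed
  ultimately have "hyperbolic (\<Sum>k\<le>n. smult (coeff g k) (\<tau> k)) \<or> (\<Sum>k\<le>n. smult (coeff g k) (\<tau> k)) = 0"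
    using g by (intro stable_symbol_imp_preserver)
  moreover have "(\<Sum>k\<le>n. smult (coeff g k) (\<tau> k)) = T f"
    unfolding linear_op_Rn_expand[OF T f(1)] g_def \<tau>_def coeff_pcompose_linear smult_smult
  proof (intro sum.cong refl)
    fix k
    have "s ^ k * coeff f k * s ^ k = (s ^ k * s ^ k) * coeff f k" by (simp only: mult_ac)
    then have "s ^ k * coeff f k * s ^ k = coeff f k" unfolding ss mult_1 .
    then show "smult (s ^ k * coeff f k * s ^ k) (T (monom 1 k)) = smult (coeff f k) (T (monom 1 k))"
      by (simp only:)
  qed
  ultimately show ?thesis by simp
qed

theorem mainTheorem1:
  fixes n :: nat and T :: "real poly \<Rightarrow> real poly"
  assumes "linear_op_Rn n T"
  shows "(\<forall>f\<in>Rn n. hyperbolic f \<longrightarrow> hyperbolic (T f) \<or> T f = 0) \<longleftrightarrow>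
    ((\<exists>(\<alpha>::real poly \<Rightarrow> real) (\<beta>::real poly \<Rightarrow> real) P Q.
        linear_on_Rn n \<alpha> \<and> linear_on_Rn n \<beta> \<and> hyperbolic P \<and> hyperbolic Q \<and>
        zeros_interlace P Q \<and> (\<forall>f\<in>Rn n. T f = smult (\<alpha> f) P + smult (\<beta> f) Q))
     \<or> real_stable2 (T_symbol T n 1)
     \<or> real_stable2 (T_symbol T n (-1)))"
    (is "?preserves \<longleftrightarrow> ?pencil \<or> ?plus \<or> ?minus")
proof
  assume pres: ?preserves
  show "?pencil \<or> ?plus \<or> ?minus"
  proof (cases "\<exists>f\<in>Rn n. \<not> hyperbolic (T f) \<and> T f \<noteq> 0")
    case True
    then obtain f where "f \<in> Rn n" "\<not> hyperbolic (T f)" "T f \<noteq> 0" by blast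
    then have "?plus \<or> ?minus" using preserver_imp_stable_symbol[OF assms] pres by blast
    then show ?thesis ..
  next
    case False
    then have ?pencil by (intro hyperbolic_range_imp_pencil[OF assms]) blast
    then show ?thesis ..
  qed
next
  assume "?pencil \<or> ?plus \<or> ?minus"
  then show ?preserves
  proof (elim disjE)
    assume ?pencil
    then obtain \<alpha> \<beta> P Q where "hyperbolic P" "hyperbolic Q" "zeros_interlace P Q"
      "\<forall>f\<in>Rn n. T f = smult (\<alpha> f) P + smult (\<beta> f) Q" by blast
    then show ?preserves using interlacing_pencil by simp
  next
    assume ?plus
    then show ?preserves using real_stable2_imp_preserver[OF assms] by blast
  next
    assume ?minus
    then show ?preserves using real_stable2_imp_preserver[OF assms] by blast
  qed
qed

end
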